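(* There is an absolute constant $C>0$ such that for every integer $d\ge 2$ and every $0$-symmetric convex body $\mathbf{K}$ in $\mathbb{R}^d$ one has $$\frac{d^{3/2}}{\sqrt{2\pi e}\ \mathrm{ovr}(\mathbf{K})}\ \leq\ \mathrm{vein}(\mathbf{K})\ \leq\ C\,d^{3/2}\,\ln(2d),$$ where $\mathrm{ovr}(\mathbf{K})=\inf\left(\mathrm{vol}(\mathcal{E})/\mathrm{vol}(\mathbf{K})\right)^{1/d}$ is the outer volume ratio of $\mathbf{K}$, with the infimum taken over all ellipsoids $\mathcal{E}\supset\mathbf{K}$ and with $\mathrm{vol}(\cdot)$ denoting the volume in $\mathbb{R}^d$.
   Context: A convex body in $\mathbb{R}^d$ is a compact convex set with non-empty interior; it is $0$-symmetric if it is symmetric about the origin $0$. For a $0$-symmetric convex body $\mathbf{K}\subset\mathbb{R}^d$, $d\ge 2$, let $\|x\|_{\mathbf{K}}=\inf\{\lambda>0 : x\in\lambda\mathbf{K}\}$ be the norm with unit ball $\mathbf{K}$. The vertex index of $\mathbf{K}$ is $$\mathrm{vein}(\mathbf{K})=\inf\Big\{\sum_i\|p_i\|_{\mathbf{K}} : \mathbf{K}\subset\mathrm{conv}\{p_i\}\Big\},$$ where the infimum is over all finite families of points $p_1,\dots,p_n\in\mathbb{R}^d$ whose convex hull contains $\mathbf{K}$. *)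

theory Defs
  imports "HOL-Analysis.Analysis" "HOL-Library.Function_Algebras"
begin

text \<open>
  The dimension has to be a natural number that can be quantified inside a formula, because the
  constant in the theorem must not depend on it. Hence the space of dimension \<open>d\<close> is the topological
  space \<^const>\<open>Euclidean_space\<close> \<open>d\<close>, whose points are the sequences \<open>x\<close> with \<open>x i = 0\<close> for \<open>i \<ge> d\<close>.
  The pointwise vector space structure on sequences makes \<^const>\<open>convex\<close>, \<^const>\<open>linear\<close> and
  convex hulls available on it.
\<close>

instantiation "fun" :: (type, real_vector) real_vector
begin

definition scaleR_fun :: "real \<Rightarrow> ('a \<Rightarrow> 'b) \<Rightarrow> 'a \<Rightarrow> 'b"
  where "scaleR_fun r f = (\<lambda>x. r *\<^sub>R f x)"

instance
  by standard (simp_all add: scaleR_fun_def fun_eq_iff scaleR_add_right scaleR_add_left)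

end

definition vec_space :: "nat \<Rightarrow> (nat \<Rightarrow> real) set"
  where "vec_space d = topspace (Euclidean_space d)"

definition convex_body :: "nat \<Rightarrow> (nat \<Rightarrow> real) set \<Rightarrow> bool"
  where "convex_body d K \<longleftrightarrow>
    compactin (Euclidean_space d) K \<and> convex K \<and> Euclidean_space d interior_of K \<noteq> {}"

definition origin_symmetric :: "(nat \<Rightarrow> real) set \<Rightarrow> bool"
  where "origin_symmetric K \<longleftrightarrow> (\<forall>x\<in>K. - x \<in> K)"

definition body_norm :: "(nat \<Rightarrow> real) set \<Rightarrow> (nat \<Rightarrow> real) \<Rightarrow> real"
  where "body_norm K x = Inf {l. l > 0 \<and> x \<in> (\<lambda>y. l *\<^sub>R y) ` K}"

text \<open>Finite families of points, with repetitions allowed, are lists.\<close>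

definition vein :: "nat \<Rightarrow> (nat \<Rightarrow> real) set \<Rightarrow> real"
  where "vein d K =
    Inf {\<Sum>p\<leftarrow>ps. body_norm K p | ps. set ps \<subseteq> vec_space d \<and> K \<subseteq> convex hull (set ps)}"

text \<open>
  Points of the product measure space are functions on \<open>{..<d}\<close> that are \<open>undefined\<close> elsewhere,
  so sequences are restricted to their first \<open>d\<close> coordinates before they are measured.
\<close>

definition vol :: "nat \<Rightarrow> (nat \<Rightarrow> real) set \<Rightarrow> real"
  where "vol d S = measure (\<Pi>\<^sub>M i\<in>{..<d}. lborel) ((\<lambda>x. restrict x {..<d}) ` S)"

definition unit_ball :: "nat \<Rightarrow> (nat \<Rightarrow> real) set"
  where "unit_ball d = {x \<in> vec_space d. (\<Sum>i<d. (x i)\<^sup>2) \<le> 1}"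

text \<open>
  Ellipsoids, with arbitrary centre \<open>c\<close>. By finite dimensionality, \<open>T ` vec_space d = vec_space d\<close>
  says that \<open>T\<close> restricts to a linear automorphism of \<open>vec_space d\<close>; its values on the other
  sequences do not matter.
\<close>

definition ellipsoid :: "nat \<Rightarrow> (nat \<Rightarrow> real) set \<Rightarrow> bool"
  where "ellipsoid d E \<longleftrightarrow>
    (\<exists>T c. linear T \<and> T ` vec_space d = vec_space d \<and> c \<in> vec_space d \<and>
           E = (\<lambda>x. c + T x) ` unit_ball d)"

definition ovr :: "nat \<Rightarrow> (nat \<Rightarrow> real) set \<Rightarrow> real"
  where "ovr d K = Inf {root d (vol d E / vol d K) | E. ellipsoid d E \<and> K \<subseteq> E}"

end

theory Submission
  imports Defs "Jordan_Normal_Form.Determinant"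
begin

text \<open>
  Upper bound: if points \<open>u\<^sub>i \<in> K\<close> with weights \<open>w\<^sub>i\<close> of sum 1 have moment matrix
  \<open>A = \<Sum>\<^sub>i w\<^sub>i u\<^sub>i u\<^sub>i\<^sup>T\<close> and \<open>x\<^sup>T A\<^sup>-\<^sup>1 x \<le> 4 d\<close> on \<open>K\<close>, then \<open>x = A (A\<^sup>-\<^sup>1 x)\<close> is a combination of the \<open>u\<^sub>i\<close>
  with coefficients of absolute sum at most \<open>2 \<surd>d\<close>, by Cauchy-Schwarz; so \<open>K\<close> lies in the convex hull of
  the \<open>\<plusminus> 2 \<surd>d u\<^sub>i\<close>. Starting from an approximate Auerbach basis of \<open>K\<close>, barycentric coordinate ascent on
  \<open>det A\<close> reaches such weights with \<open>O(d ln d)\<close> points, which replaces Rudelson's theorem on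
  John decompositions.

  Lower bound: let \<open>K\<close> lie in the convex hull of \<open>P\<close> and in an ellipsoid, which may be taken to be a linear
  image \<open>T B\<close> of the unit ball. By Caratheodory's theorem for cones, the hull is covered by the simplices
  spanned by 0 and the bases \<open>I \<subseteq> P\<close>. By Hadamard's inequality such a simplex has volume at most
  \<open>\<bar>det T\<bar> / d!\<close> times the product of \<open>\<bar>T\<^sup>-\<^sup>1 p\<bar> \<le> \<parallel>p\<parallel>\<^sub>K\<close> over \<open>p \<in> I\<close>, and these products sum to at most
  \<open>(\<Sum>\<parallel>p\<parallel>\<^sub>K)\<^sup>d / d!\<close>. The ball contains a cube of side \<open>2 / \<surd>d\<close>, and the constant follows from
  \<open>d! \<ge> (d / e)\<^sup>d\<close> and \<open>e\<^sup>3 \<le> 8 \<pi>\<close>.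
\<close>

section \<open>Lebesgue measure on finitely supported sequences\<close>

definition extend_zero :: "nat \<Rightarrow> (nat \<Rightarrow> real) \<Rightarrow> nat \<Rightarrow> real"
  where "extend_zero d x = (\<lambda>i. if i < d then x i else 0)"

text \<open>Lebesgue measure of the first \<open>d\<close> coordinates, carried to the Borel sets of
  all sequences and concentrated on \<open>vec_space d\<close>. On total sequences the vector
  operations can be used under the integral.\<close>

definition leb :: "nat \<Rightarrow> (nat \<Rightarrow> real) measure"
  where "leb d = distr (\<Pi>\<^sub>M i\<in>{..<d}. lborel) borel (extend_zero d)"

text \<open>A matrix is the family of its columns; only the first \<open>d\<close> columns count.\<close>

definition col_comb :: "nat \<Rightarrow> (nat \<Rightarrow> nat \<Rightarrow> real) \<Rightarrow> (nat \<Rightarrow> real) \<Rightarrow> nat \<Rightarrow> real"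
  where "col_comb d q x = (\<lambda>i. \<Sum>j<d. x j * q j i)"

lemma vec_space_iff: "x \<in> vec_space d \<longleftrightarrow> (\<forall>i\<ge>d. x i = 0)"
  by (simp add: vec_space_def topspace_Euclidean_space)

lemma space_leb [simp]: "space (leb d) = UNIV"
  and sets_leb [simp, measurable_cong]: "sets (leb d) = sets borel"
  by (simp_all add: leb_def)

lemma measurable_extend_zero [measurable]: "extend_zero d \<in> (\<Pi>\<^sub>M i\<in>{..<d}. lborel) \<rightarrow>\<^sub>M borel"
proof (rule measurable_coordinatewise_then_product)
  fix i
  show "(\<lambda>x. extend_zero d x i) \<in> borel_measurable (\<Pi>\<^sub>M i\<in>{..<d}. lborel)"
    by (cases "i < d") (auto simp: extend_zero_def)
qed

lemma measurable_plus_fun [measurable]: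
  fixes f g :: "'a \<Rightarrow> nat \<Rightarrow> real"
  assumes [measurable]: "f \<in> borel_measurable M" "g \<in> borel_measurable M"
  shows "(\<lambda>x. f x + g x) \<in> borel_measurable M"
proof (rule measurable_coordinatewise_then_product)
  fix i
  have [measurable]: "(\<lambda>x. f x i) \<in> borel_measurable M" "(\<lambda>x. g x i) \<in> borel_measurable M"
    by (rule measurable_product_then_coordinatewise, fact)+
  show "(\<lambda>x. (f x + g x) i) \<in> borel_measurable M"
    by simp
qed

lemma measurable_minus_fun [measurable]:
  fixes f g :: "'a \<Rightarrow> nat \<Rightarrow> real"
  assumes [measurable]: "f \<in> borel_measurable M" "g \<in> borel_measurable M"
  shows "(\<lambda>x. f x - g x) \<in> borel_measurable M"
proof (rule measurable_coordinatewise_then_product)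
  fix i
  have [measurable]: "(\<lambda>x. f x i) \<in> borel_measurable M" "(\<lambda>x. g x i) \<in> borel_measurable M"
    by (rule measurable_product_then_coordinatewise, fact)+
  show "(\<lambda>x. (f x - g x) i) \<in> borel_measurable M"
    by simp
qed

lemma measurable_uminus_fun [measurable]:
  fixes f :: "'a \<Rightarrow> nat \<Rightarrow> real"
  assumes [measurable]: "f \<in> borel_measurable M"
  shows "(\<lambda>x. - f x) \<in> borel_measurable M"
proof (rule measurable_coordinatewise_then_product)
  fix i
  have [measurable]: "(\<lambda>x. f x i) \<in> borel_measurable M"
    by (rule measurable_product_then_coordinatewise, fact)
  show "(\<lambda>x. (- f x) i) \<in> borel_measurable M"
    by simp
qed

lemma measurable_col_comb [measurable]:
  assumes [measurable]: "f \<in> borel_measurable M"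
  shows "(\<lambda>x. col_comb d q (f x)) \<in> borel_measurable M"
proof -
  have [measurable]: "(\<lambda>x. f x i) \<in> borel_measurable M" for i
    by (rule measurable_product_then_coordinatewise, fact)
  show ?thesis
    unfolding col_comb_def by (rule measurable_coordinatewise_then_product) simp
qed

text \<open>Lets identities valid only on \<open>vec_space d\<close>, such as those in
  \<open>inverse_cols\<close>, be used under integrals.\<close>

lemma AE_leb_vec_space: "AE x in leb d. x \<in> vec_space d"
  unfolding leb_def
  by (subst AE_distr_iff) (auto simp: vec_space_iff extend_zero_def)

lemma emeasure_leb_box:
  assumes "\<And>i. i < d \<Longrightarrow> a i \<le> b i"
  shows "emeasure (leb d) {x. \<forall>i<d. a i \<le> x i \<and> x i \<le> b i} = (\<Prod>i<d. ennreal (b i - a i))"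
proof -
  interpret product_sigma_finite "\<lambda>_::nat. lborel :: real measure" by standard
  have [measurable]: "{x::nat\<Rightarrow>real. \<forall>i<d. a i \<le> x i \<and> x i \<le> b i} \<in> sets borel"
    by measurable
  have "emeasure (leb d) {x. \<forall>i<d. a i \<le> x i \<and> x i \<le> b i} =
      emeasure (\<Pi>\<^sub>M i\<in>{..<d}. lborel) (\<Pi>\<^sub>E i\<in>{..<d}. {a i..b i})"
  proof -
    have "extend_zero d -` {x. \<forall>i<d. a i \<le> x i \<and> x i \<le> b i} \<inter> space (\<Pi>\<^sub>M i\<in>{..<d}. lborel) =
        (\<Pi>\<^sub>E i\<in>{..<d}. {a i..b i})"
      by (intro Set.set_eqI) (simp add: extend_zero_def space_PiM PiE_iff Ball_def conj_commute)
    then show ?thesis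
      unfolding leb_def by (simp only: emeasure_distr[OF measurable_extend_zero \<open>_ \<in> sets borel\<close>])
  qed
  also have "\<dots> = (\<Prod>i<d. emeasure lborel {a i..b i})"
    by (rule emeasure_PiM) auto
  also have "\<dots> = (\<Prod>i<d. ennreal (b i - a i))"
    using assms by (intro prod.cong) auto
  finally show ?thesis .
qed

lemma sigma_finite_leb: "sigma_finite_measure (leb d)"
proof
  define A where "A n = {x::nat\<Rightarrow>real. \<forall>i<d. - real n \<le> x i \<and> x i \<le> real n}" for n
  have "A n \<in> sets borel" for n
    unfolding A_def by measurable
  moreover have "(\<Union>n. A n) = UNIV"
  proof -
    have "\<exists>n. x \<in> A n" for x
    proof -
      obtain n where n: "(\<Sum>i<d. \<bar>x i\<bar>) \<le> real n"
        using real_arch_simple by blast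
      have "\<bar>x i\<bar> \<le> real n" if "i < d" for i
        using member_le_sum[of i "{..<d}" "\<lambda>i. \<bar>x i\<bar>"] that n by force
      then show ?thesis
        by (auto simp: A_def abs_le_iff intro!: exI[of _ n]) (meson minus_le_iff)
    qed
    then show ?thesis by auto
  qed
  moreover have "emeasure (leb d) (A n) \<noteq> \<infinity>" for n
    unfolding A_def by (subst emeasure_leb_box) (auto simp: ennreal_power)
  ultimately show "\<exists>A. countable A \<and> A \<subseteq> sets (leb d) \<and> \<Union> A = space (leb d) \<and>
      (\<forall>a\<in>A. emeasure (leb d) a \<noteq> \<infinity>)"
    by (intro exI[of _ "range A"]) auto
qed

section \<open>Translation invariance and scaling under linear maps\<close>

text \<open>Measures on the product space agree once they agree on boxes, and there the claim is the
  translation invariance of one-dimensional Lebesgue measure in each factor.\<close>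

lemma distr_leb_translation:
  assumes c: "c \<in> vec_space d"
  shows "distr (leb d) borel (\<lambda>x. x + c) = leb d"
proof -
  let ?P = "\<Pi>\<^sub>M i\<in>{..<d}. (lborel :: real measure)"
  let ?t = "\<lambda>x. \<lambda>i\<in>{..<d}. x i + c i"
  interpret product_sigma_finite "\<lambda>_::nat. lborel :: real measure" by standard
  have t[measurable]: "?t \<in> ?P \<rightarrow>\<^sub>M ?P"
    by measurable
  have "distr ?P ?P ?t = ?P"
  proof (rule PiM_eqI)
    fix A :: "nat \<Rightarrow> real set" assume A: "\<And>i. i \<in> {..<d} \<Longrightarrow> A i \<in> sets lborel"
    have "emeasure (distr ?P ?P ?t) (Pi\<^sub>E {..<d} A) = emeasure ?P (?t -` (Pi\<^sub>E {..<d} A) \<inter> space ?P)"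
      using A by (subst emeasure_distr) (auto intro!: sets_PiM_I_finite)
    also have "?t -` (Pi\<^sub>E {..<d} A) \<inter> space ?P = (\<Pi>\<^sub>E i\<in>{..<d}. (\<lambda>y. c i + y) -` A i)"
      by (auto simp: space_PiM PiE_iff add.commute)
    also have "emeasure ?P \<dots> = (\<Prod>i<d. emeasure lborel ((\<lambda>y. c i + y) -` A i))"
      using A by (intro emeasure_PiM) (auto intro!: measurable_sets_borel[of _ borel])
    also have "\<dots> = (\<Prod>i<d. emeasure lborel (A i))"
    proof (rule prod.cong)
      fix i assume i: "i \<in> {..<d}"
      have "emeasure lborel (A i) = emeasure (distr lborel borel ((+) (c i))) (A i)"
        by (simp add: lborel_distr_plus)
      also have "\<dots> = emeasure lborel ((\<lambda>y. c i + y) -` A i)"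
        using A[OF i] by (subst emeasure_distr) auto
      finally show "emeasure lborel ((\<lambda>y. c i + y) -` A i) = emeasure lborel (A i)" ..
    qed simp
    finally show "emeasure (distr ?P ?P ?t) (Pi\<^sub>E {..<d} A) = (\<Prod>i\<in>{..<d}. emeasure lborel (A i))" .
  qed auto
  then have "leb d = distr (distr ?P ?P ?t) borel (extend_zero d)"
    by (simp only: leb_def)
  also have "\<dots> = distr ?P borel (\<lambda>x. extend_zero d (?t x))"
    by (subst distr_distr) (auto simp: o_def)
  also have "\<dots> = distr ?P borel (\<lambda>x. extend_zero d x + c)"
    using c by (intro distr_cong) (auto simp: extend_zero_def vec_space_iff)
  also have "\<dots> = distr (leb d) borel (\<lambda>x. x + c)"
    unfolding leb_def by (subst distr_distr) (auto simp: o_def)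
  finally show ?thesis ..
qed

lemma nn_integral_leb_translation:
  assumes "c \<in> vec_space d" and [measurable]: "f \<in> borel_measurable borel"
  shows "(\<integral>\<^sup>+x. f (x + c) \<partial>leb d) = (\<integral>\<^sup>+x. f x \<partial>leb d)"
proof -
  have "(\<integral>\<^sup>+x. f x \<partial>leb d) = (\<integral>\<^sup>+x. f x \<partial>distr (leb d) borel (\<lambda>x. x + c))"
    by (simp only: distr_leb_translation[OF assms(1)])
  also have "\<dots> = (\<integral>\<^sup>+x. f (x + c) \<partial>leb d)"
    by (rule nn_integral_distr) auto
  finally show ?thesis ..
qed

lemma col_comb_add: "col_comb d q (x + y) = col_comb d q x + col_comb d q y"
  by (auto simp: col_comb_def fun_eq_iff algebra_simps sum.distrib)

text \<open>Invertibility with an explicit inverse. The identities can hold only on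
  \<open>vec_space d\<close>, because \<open>col_comb d q\<close> ignores the coordinates from
  \<open>d\<close> on.\<close>

definition inverse_cols :: "nat \<Rightarrow> (nat \<Rightarrow> nat \<Rightarrow> real) \<Rightarrow> (nat \<Rightarrow> nat \<Rightarrow> real) \<Rightarrow> bool"
  where "inverse_cols d q q' \<longleftrightarrow> (\<forall>j<d. q j \<in> vec_space d \<and> q' j \<in> vec_space d) \<and>
    (\<forall>x\<in>vec_space d. col_comb d q (col_comb d q' x) = x \<and> col_comb d q' (col_comb d q x) = x)"

lemma inverse_cols_sym: "inverse_cols d q q' \<Longrightarrow> inverse_cols d q' q"
  by (auto simp: inverse_cols_def)

lemma col_comb_in_vec_space:
  assumes "\<And>j. j < d \<Longrightarrow> q j \<in> vec_space d"
  shows "col_comb d q x \<in> vec_space d"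
  using assms by (auto simp: col_comb_def vec_space_iff intro!: sum.neutral)

text \<open>
  Uniqueness of Haar measure in place of a change of variables formula: both sides are
  double integrals of \<open>1\<^sub>B y * 1\<^sub>A (N x + y)\<close>, after translating \<open>x\<close> or \<open>y\<close>.
\<close>

lemma emeasure_vimage_mult_swap:
  assumes "inverse_cols d q q'" and [measurable]: "A \<in> sets borel" "B \<in> sets borel"
  shows "emeasure (leb d) {x. col_comb d q x \<in> A} * emeasure (leb d) B =
         emeasure (leb d) A * emeasure (leb d) {x. - col_comb d q x \<in> B}"
proof -
  interpret sigma_finite_measure "leb d" by (rule sigma_finite_leb)
  interpret pair_sigma_finite "leb d" "leb d" ..
  let ?N = "col_comb d q" and ?M = "col_comb d q'"
  let ?I = "indicator :: _ \<Rightarrow> _ \<Rightarrow> ennreal"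
  have V: "?N x \<in> vec_space d" "- ?N x \<in> vec_space d" "?M x \<in> vec_space d" for x
    using assms(1) col_comb_in_vec_space[of d q x] col_comb_in_vec_space[of d q' x]
    by (auto simp: inverse_cols_def vec_space_iff)
  have NM: "?N (?M y) = y" if "y \<in> vec_space d" for y
    using assms(1) that by (auto simp: inverse_cols_def)
  have "emeasure (leb d) {x. ?N x \<in> A} * emeasure (leb d) B =
      (\<integral>\<^sup>+y. ?I B y \<partial>leb d) * (\<integral>\<^sup>+x. ?I A (?N x) \<partial>leb d)"
  proof -
    have "(\<integral>\<^sup>+x. ?I A (?N x) \<partial>leb d) = (\<integral>\<^sup>+x. ?I {x. ?N x \<in> A} x \<partial>leb d)"
      by (intro nn_integral_cong) (auto simp: indicator_def)
    also have "\<dots> = emeasure (leb d) {x. ?N x \<in> A}"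
      by (rule nn_integral_indicator) simp
    finally show ?thesis
      by (simp add: mult.commute)
  qed
  also have "\<dots> = (\<integral>\<^sup>+y. ?I B y * (\<integral>\<^sup>+x. ?I A (?N x) \<partial>leb d) \<partial>leb d)"
    by (subst nn_integral_multc) auto
  also have "\<dots> = (\<integral>\<^sup>+y. \<integral>\<^sup>+x. ?I B y * ?I A (?N x + y) \<partial>leb d \<partial>leb d)"
  proof (rule nn_integral_cong_AE)
    show "AE y in leb d. ?I B y * (\<integral>\<^sup>+x. ?I A (?N x) \<partial>leb d) =
        (\<integral>\<^sup>+x. ?I B y * ?I A (?N x + y) \<partial>leb d)"
      using AE_leb_vec_space
    proof eventually_elim
      fix y assume y: "y \<in> vec_space d"
      \<comment> \<open>The shift by \<open>?M y\<close> adds \<open>?N (?M y) = y\<close> to the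
        argument, which needs \<open>y\<close> in \<open>vec_space d\<close>.\<close>
      have "(\<integral>\<^sup>+x. ?I A (?N x) \<partial>leb d) = (\<integral>\<^sup>+x. ?I A (?N (x + ?M y)) \<partial>leb d)"
        using V by (subst nn_integral_leb_translation[of "?M y" d "\<lambda>x. ?I A (?N x)"]) auto
      then show "?I B y * (\<integral>\<^sup>+x. ?I A (?N x) \<partial>leb d) =
          (\<integral>\<^sup>+x. ?I B y * ?I A (?N x + y) \<partial>leb d)"
        by (subst nn_integral_cmult) (auto simp: col_comb_add NM y)
    qed
  qed
  also have "\<dots> = (\<integral>\<^sup>+x. \<integral>\<^sup>+y. ?I B y * ?I A (?N x + y) \<partial>leb d \<partial>leb d)"
    by (rule Fubini') simp
  also have "\<dots> = (\<integral>\<^sup>+x. \<integral>\<^sup>+y. ?I B (y + - ?N x) * ?I A y \<partial>leb d \<partial>leb d)"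
  proof (rule nn_integral_cong)
    fix x
    show "(\<integral>\<^sup>+y. ?I B y * ?I A (?N x + y) \<partial>leb d) = (\<integral>\<^sup>+y. ?I B (y + - ?N x) * ?I A y \<partial>leb d)"
      \<comment> \<open>Shifting \<open>y\<close> by \<open>- ?N x\<close> moves the dependence on
        \<open>x\<close> from \<open>A\<close> to \<open>B\<close>.\<close>
      using V by (subst nn_integral_leb_translation[of "- ?N x" d "\<lambda>y. ?I B y * ?I A (?N x + y)", symmetric]) auto
  qed
  also have "\<dots> = (\<integral>\<^sup>+y. \<integral>\<^sup>+x. ?I B (y + - ?N x) * ?I A y \<partial>leb d \<partial>leb d)"
    by (rule Fubini') simp
  also have "\<dots> = (\<integral>\<^sup>+y. (\<integral>\<^sup>+x. ?I B (- ?N x) \<partial>leb d) * ?I A y \<partial>leb d)"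
  proof (rule nn_integral_cong_AE)
    show "AE y in leb d. (\<integral>\<^sup>+x. ?I B (y + - ?N x) * ?I A y \<partial>leb d) =
        (\<integral>\<^sup>+x. ?I B (- ?N x) \<partial>leb d) * ?I A y"
      using AE_leb_vec_space
    proof eventually_elim
      fix y assume y: "y \<in> vec_space d"
      \<comment> \<open>The same shift of \<open>x\<close> now cancels \<open>y\<close>, so that the
        inner integral no longer depends on \<open>y\<close>.\<close>
      have "(\<integral>\<^sup>+x. ?I B (y + - ?N x) \<partial>leb d) = (\<integral>\<^sup>+x. ?I B (y + - ?N (x + ?M y)) \<partial>leb d)"
        using V by (subst nn_integral_leb_translation[of "?M y" d "\<lambda>x. ?I B (y + - ?N x)"]) auto
      also have "\<dots> = (\<integral>\<^sup>+x. ?I B (- ?N x) \<partial>leb d)"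
        by (simp add: col_comb_add NM y)
      finally show "(\<integral>\<^sup>+x. ?I B (y + - ?N x) * ?I A y \<partial>leb d) =
          (\<integral>\<^sup>+x. ?I B (- ?N x) \<partial>leb d) * ?I A y"
        by (subst nn_integral_multc) auto
    qed
  qed
  also have "\<dots> = (\<integral>\<^sup>+x. ?I B (- ?N x) \<partial>leb d) * emeasure (leb d) A"
    by (subst nn_integral_cmult) auto
  also have "(\<integral>\<^sup>+x. ?I B (- ?N x) \<partial>leb d) = emeasure (leb d) {x. - ?N x \<in> B}"
  proof -
    have "(\<integral>\<^sup>+x. ?I B (- ?N x) \<partial>leb d) = (\<integral>\<^sup>+x. ?I {x. - ?N x \<in> B} x \<partial>leb d)"
      by (intro nn_integral_cong) (auto simp: indicator_def)
    also have "\<dots> = emeasure (leb d) {x. - ?N x \<in> B}"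
      by (rule nn_integral_indicator) simp
    finally show ?thesis .
  qed
  finally show ?thesis
    by (simp add: mult.commute)
qed

section \<open>Volume of linear images\<close>

definition cube :: "nat \<Rightarrow> (nat \<Rightarrow> real) set"
  where "cube d = {x. \<forall>i<d. - 1 \<le> x i \<and> x i \<le> 1}"

text \<open>Since preimages are measured, this is \<open>1 / \<bar>det q\<bar>\<close> for an invertible matrix \<open>q\<close>.\<close>

definition vimage_factor :: "nat \<Rightarrow> (nat \<Rightarrow> nat \<Rightarrow> real) \<Rightarrow> ennreal"
  where "vimage_factor d q = emeasure (leb d) {x. col_comb d q x \<in> cube d} / 2 ^ d"

definition norm_sq :: "nat \<Rightarrow> (nat \<Rightarrow> real) \<Rightarrow> real"
  where "norm_sq d x = (\<Sum>i<d. (x i)\<^sup>2)"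

lemma cube_borel [measurable]: "cube d \<in> sets borel"
  unfolding cube_def by measurable

lemma ennreal_mult_divide_power2: "x * 2 ^ d / 2 ^ d = (x::ennreal)"
proof -
  have "(2::ennreal) ^ d \<noteq> Orderings.top"
    by (induction d) (auto simp: ennreal_mult_eq_top_iff)
  then show ?thesis
    by (intro ennreal_mult_divide_eq) auto
qed

lemma emeasure_leb_cube: "emeasure (leb d) (cube d) = 2 ^ d"
  unfolding cube_def by (subst emeasure_leb_box) auto

lemma vec_space_borel [measurable]: "vec_space d \<in> sets borel"
proof -
  have "vec_space d = {x. \<forall>i\<in>{d..}. x i = 0}"
    by (auto simp: vec_space_iff)
  also have "\<dots> \<in> sets borel"
    by measurable
  finally show ?thesis .
qed

lemma measurable_norm_sq [measurable]: "norm_sq d \<in> borel_measurable borel"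
  unfolding norm_sq_def by measurable

lemma col_comb_minus: "col_comb d q (- x) = - col_comb d q x"
  by (auto simp: col_comb_def fun_eq_iff sum_negf)

text \<open>The swap identity with \<open>B\<close> the cube. Its symmetry removes the minus sign,
  and its measure \<open>2 ^ d\<close> is finite and nonzero, so it cancels.\<close>

lemma emeasure_col_comb_vimage:
  assumes "inverse_cols d q q'" and [measurable]: "A \<in> sets borel"
  shows "emeasure (leb d) {x. col_comb d q x \<in> A} = vimage_factor d q * emeasure (leb d) A"
proof -
  let ?a = "emeasure (leb d) {x. col_comb d q x \<in> A}"
  have "{x. - col_comb d q x \<in> cube d} = {x. col_comb d q x \<in> cube d}"
    by (auto simp: cube_def minus_le_iff)
  then have *: "?a * 2 ^ d = emeasure (leb d) A * emeasure (leb d) {x. col_comb d q x \<in> cube d}"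
    using emeasure_vimage_mult_swap[OF assms cube_borel[of d]] by (simp add: emeasure_leb_cube)
  have "?a = ?a * 2 ^ d / 2 ^ d"
    by (rule ennreal_mult_divide_power2[symmetric])
  then show ?thesis
    unfolding * vimage_factor_def by (simp add: ennreal_times_divide mult.commute)
qed

lemma distr_col_comb:
  assumes "inverse_cols d q q'"
  shows "distr (leb d) borel (col_comb d q) = scale_measure (vimage_factor d q) (leb d)"
proof (rule measure_eqI)
  fix A assume "A \<in> sets (distr (leb d) borel (col_comb d q))"
  then have [measurable]: "A \<in> sets borel" by simp
  have "emeasure (distr (leb d) borel (col_comb d q)) A = emeasure (leb d) {x. col_comb d q x \<in> A}"
    by (subst emeasure_distr) (auto simp: vimage_def)
  then show "emeasure (distr (leb d) borel (col_comb d q)) A = emeasure (scale_measure (vimage_factor d q) (leb d)) A"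
    using emeasure_col_comb_vimage[OF assms] by simp
qed simp

lemma nn_integral_col_comb:
  assumes "inverse_cols d q q'" and [measurable]: "f \<in> borel_measurable borel"
  shows "(\<integral>\<^sup>+x. f (col_comb d q x) \<partial>leb d) = vimage_factor d q * (\<integral>\<^sup>+x. f x \<partial>leb d)"
proof -
  have "(\<integral>\<^sup>+x. f (col_comb d q x) \<partial>leb d) = (\<integral>\<^sup>+x. f x \<partial>distr (leb d) borel (col_comb d q))"
    by (rule nn_integral_distr[symmetric]) auto
  also have "\<dots> = vimage_factor d q * (\<integral>\<^sup>+x. f x \<partial>leb d)"
    unfolding distr_col_comb[OF assms(1)]
    by (rule nn_integral_scale_measure) simp
  finally show ?thesis .
qed

text \<open>Pulling the cube back along both maps returns the cube up to a null set. Besides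
  multiplicativity this is the source of finiteness of the factors.\<close>

lemma vimage_factor_inverse:
  assumes "inverse_cols d q q'"
  shows "vimage_factor d q * vimage_factor d q' = 1"
proof -
  have "(2::ennreal) ^ d = emeasure (leb d) {x. col_comb d q' x \<in> {y. col_comb d q y \<in> cube d}}"
  proof -
    have "emeasure (leb d) (cube d) = emeasure (leb d) {x. col_comb d q' x \<in> {y. col_comb d q y \<in> cube d}}"
    proof (rule emeasure_eq_AE)
      show "AE x in leb d. x \<in> cube d \<longleftrightarrow> x \<in> {x. col_comb d q' x \<in> {y. col_comb d q y \<in> cube d}}"
        using AE_leb_vec_space
        by eventually_elim (use assms in \<open>auto simp: inverse_cols_def\<close>)
    qed auto
    then show ?thesis by (simp add: emeasure_leb_cube)
  qed
  also have "\<dots> = vimage_factor d q' * emeasure (leb d) {y. col_comb d q y \<in> cube d}"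
    by (rule emeasure_col_comb_vimage[OF inverse_cols_sym[OF assms]]) simp
  also have "\<dots> = vimage_factor d q' * (vimage_factor d q * 2 ^ d)"
    by (subst emeasure_col_comb_vimage[OF assms]) (auto simp: emeasure_leb_cube)
  finally have "1 * (2::ennreal) ^ d = (vimage_factor d q * vimage_factor d q') * 2 ^ d"
    by (simp add: mult_ac)
  then have "1 * (2::ennreal) ^ d / 2 ^ d = (vimage_factor d q * vimage_factor d q') * 2 ^ d / 2 ^ d"
    by simp
  then show ?thesis
    by (simp only: ennreal_mult_divide_power2)
qed

text \<open>The matrix product in the column convention.\<close>

definition comp_cols :: "nat \<Rightarrow> (nat \<Rightarrow> nat \<Rightarrow> real) \<Rightarrow> (nat \<Rightarrow> nat \<Rightarrow> real) \<Rightarrow> nat \<Rightarrow> nat \<Rightarrow> real"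
  where "comp_cols d a b = (\<lambda>j. col_comb d a (b j))"

lemma col_comb_comp: "col_comb d (comp_cols d a b) x = col_comb d a (col_comb d b x)"
proof
  fix i
  have "col_comb d (comp_cols d a b) x i = (\<Sum>j<d. \<Sum>k<d. x j * (b j k * a k i))"
    by (simp add: col_comb_def comp_cols_def sum_distrib_left)
  also have "\<dots> = (\<Sum>k<d. \<Sum>j<d. x j * (b j k * a k i))"
    by (rule sum.swap)
  also have "\<dots> = col_comb d a (col_comb d b x) i"
    by (simp add: col_comb_def sum_distrib_right mult.assoc)
  finally show "col_comb d (comp_cols d a b) x i = col_comb d a (col_comb d b x) i" .
qed

lemma inverse_cols_comp:
  assumes "inverse_cols d a a'" "inverse_cols d b b'"
  shows "inverse_cols d (comp_cols d a b) (comp_cols d b' a')"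
  unfolding inverse_cols_def col_comb_comp
  using assms by (auto simp: inverse_cols_def comp_cols_def col_comb_in_vec_space)

lemma vimage_factor_comp:
  assumes "inverse_cols d a a'" "inverse_cols d b b'"
  shows "vimage_factor d (comp_cols d a b) = vimage_factor d a * vimage_factor d b"
proof -
  have "emeasure (leb d) {x. col_comb d b x \<in> {y. col_comb d a y \<in> cube d}} = vimage_factor d b * (vimage_factor d a * 2 ^ d)"
    by (subst emeasure_col_comb_vimage[OF assms(2)], simp, subst emeasure_col_comb_vimage[OF assms(1)])
       (auto simp: emeasure_leb_cube)
  then have "vimage_factor d (comp_cols d a b) = vimage_factor d a * vimage_factor d b * 2 ^ d / 2 ^ d"
    by (simp add: vimage_factor_def[of d "comp_cols d a b"] col_comb_comp mult_ac)
  then show ?thesis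
    by (simp only: ennreal_mult_divide_power2)
qed

section \<open>Diagonal matrices and sign changes\<close>

definition diag_cols :: "nat \<Rightarrow> (nat \<Rightarrow> real) \<Rightarrow> nat \<Rightarrow> nat \<Rightarrow> real"
  where "diag_cols d r = (\<lambda>j i. if i = j \<and> i < d then r j else 0)"

lemma col_comb_diag: "col_comb d (diag_cols d r) x = (\<lambda>i. if i < d then r i * x i else 0)"
  by (auto simp: col_comb_def diag_cols_def fun_eq_iff if_distrib[of "\<lambda>y. _ * y"] sum.delta' cong: if_cong)

lemma inverse_cols_diag:
  assumes "\<And>i. i < d \<Longrightarrow> r i \<noteq> 0"
  shows "inverse_cols d (diag_cols d r) (diag_cols d (\<lambda>i. 1 / r i))"
  unfolding inverse_cols_def col_comb_diag using assms by (auto simp: diag_cols_def vec_space_iff fun_eq_iff)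

lemma vimage_factor_diag:
  assumes "\<And>i. i < d \<Longrightarrow> r i > 0"
  shows "vimage_factor d (diag_cols d r) = (\<Prod>i<d. ennreal (1 / r i))"
proof -
  have "{x. col_comb d (diag_cols d r) x \<in> cube d} = {x. \<forall>i<d. - (1 / r i) \<le> x i \<and> x i \<le> 1 / r i}"
  proof -
    have "(- 1 \<le> r i * x i \<and> r i * x i \<le> 1) \<longleftrightarrow> (- (1 / r i) \<le> x i \<and> x i \<le> 1 / r i)"
      if "i < d" for i x
      using assms[OF that] by (auto simp: field_simps)
    then show ?thesis
      by (auto simp: col_comb_diag cube_def)
  qed
  then have "emeasure (leb d) {x. col_comb d (diag_cols d r) x \<in> cube d} = (\<Prod>i<d. ennreal (1 / r i - - (1 / r i)))"
    using assms by (simp only:) (rule emeasure_leb_box, simp add: less_imp_le order.trans[of _ 0])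
  also have "\<dots> = (\<Prod>i<d. ennreal (1 / r i) * 2)"
  proof (rule prod.cong)
    fix i assume "i \<in> {..<d}"
    then have "r i > 0" using assms by simp
    then have "ennreal (1 / r i) * ennreal 2 = ennreal (1 / r i * 2)"
      by (subst ennreal_mult) auto
    then show "ennreal (1 / r i - - (1 / r i)) = ennreal (1 / r i) * 2"
      by simp
  qed simp
  also have "\<dots> = (\<Prod>i<d. ennreal (1 / r i)) * 2 ^ d"
    by (simp add: prod.distrib)
  finally show ?thesis
    unfolding vimage_factor_def by (simp only: ennreal_mult_divide_power2)
qed

text \<open>Sign changes map the cube to itself. They are treated apart from
  \<open>vimage_factor_diag\<close>, which needs positive entries.\<close>

lemma vimage_factor_flip:
  assumes "\<And>i. i < d \<Longrightarrow> r i = 1 \<or> r i = - 1"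
  shows "vimage_factor d (diag_cols d r) = 1"
proof -
  have "(- 1 \<le> r i * x i \<and> r i * x i \<le> 1) \<longleftrightarrow> (- 1 \<le> x i \<and> x i \<le> 1)" if "i < d" for i x
    using assms[OF that] by auto
  then have "{x. col_comb d (diag_cols d r) x \<in> cube d} = cube d"
    by (auto simp: col_comb_diag cube_def)
  then show ?thesis
    unfolding vimage_factor_def using ennreal_mult_divide_power2[of 1 d] by (simp add: emeasure_leb_cube)
qed

lemma integral_leb_flip:
  fixes f :: "(nat \<Rightarrow> real) \<Rightarrow> real"
  assumes "\<And>i. i < d \<Longrightarrow> r i = 1 \<or> r i = - 1" and [measurable]: "f \<in> borel_measurable borel"
  shows "(\<integral>x. f (col_comb d (diag_cols d r) x) \<partial>leb d) = (\<integral>x. f x \<partial>leb d)"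
proof -
  have "inverse_cols d (diag_cols d r) (diag_cols d (\<lambda>i. 1 / r i))"
    using assms(1) by (intro inverse_cols_diag) force
  then have "distr (leb d) borel (col_comb d (diag_cols d r)) = leb d"
    by (simp add: distr_col_comb vimage_factor_flip[OF assms(1)])
  then have "(\<integral>x. f x \<partial>leb d) = (\<integral>x. f x \<partial>distr (leb d) borel (col_comb d (diag_cols d r)))"
    by simp
  also have "\<dots> = (\<integral>x. f (col_comb d (diag_cols d r) x) \<partial>leb d)"
    by (rule integral_distr) auto
  finally show ?thesis ..
qed

lemma emeasure_leb_simplex:
  "emeasure (leb d) {x. (\<forall>i<d. 0 \<le> x i) \<and> (\<Sum>i<d. x i) \<le> 1} = ennreal (1 / fact d)"
proof -
  let ?S = "{x::nat\<Rightarrow>real. (\<forall>i<d. 0 \<le> x i) \<and> (\<Sum>i<d. x i) \<le> 1}"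
  have S: "?S \<in> sets borel"
    by measurable
  have "extend_zero d -` ?S \<inter> space (\<Pi>\<^sub>M i\<in>{..<d}. lborel) =
      {x. (\<forall>i\<in>{..<d}. 0 \<le> x i) \<and> sum x {..<d} \<le> 1} \<inter> space (\<Pi>\<^sub>M i\<in>{..<d}. lborel)"
    by (intro Set.set_eqI) (simp add: extend_zero_def Ball_def)
  then have "emeasure (leb d) ?S = emeasure (\<Pi>\<^sub>M i\<in>{..<d}. lborel)
      ({x::nat\<Rightarrow>real. (\<forall>i\<in>{..<d}. 0 \<le> x i) \<and> sum x {..<d} \<le> 1} \<inter> space (\<Pi>\<^sub>M i\<in>{..<d}. lborel))"
    unfolding leb_def by (simp only: emeasure_distr[OF measurable_extend_zero S])
  also have "\<dots> = ennreal (1 / fact d)"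
    by (subst emeasure_std_simplex_aux) auto
  finally show ?thesis .
qed

section \<open>Comparison of the Euclidean ball with cubes\<close>

lemma abs_le_of_norm_sq:
  assumes "norm_sq d x \<le> s\<^sup>2" "i < d" "s \<ge> 0"
  shows "\<bar>x i\<bar> \<le> s"
proof -
  have "(x i)\<^sup>2 \<le> norm_sq d x"
    unfolding norm_sq_def using assms(2) by (intro member_le_sum) auto
  then have "(x i)\<^sup>2 \<le> s\<^sup>2" using assms(1) by simp
  then show ?thesis using assms(3) abs_le_square_iff[of "x i" s] by simp
qed

lemma norm_sq_le_of_abs:
  assumes "\<And>i. i < d \<Longrightarrow> \<bar>x i\<bar> \<le> s"
  shows "norm_sq d x \<le> real d * s\<^sup>2"
proof -
  have "norm_sq d x \<le> (\<Sum>i<d. s\<^sup>2)"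
    unfolding norm_sq_def
  proof (rule sum_mono)
    fix i assume "i \<in> {..<d}"
    then have "\<bar>x i\<bar> \<le> \<bar>s\<bar>" using assms[of i] by auto
    then show "(x i)\<^sup>2 \<le> s\<^sup>2" by (simp add: abs_le_square_iff)
  qed
  then show ?thesis by simp
qed

lemma emeasure_ball_finite: "emeasure (leb d) {x. norm_sq d x \<le> 1} < \<infinity>"
proof -
  have "emeasure (leb d) {x. norm_sq d x \<le> 1} \<le> emeasure (leb d) (cube d)"
  proof (rule emeasure_mono)
    show "{x. norm_sq d x \<le> 1} \<subseteq> cube d"
    proof safe
      fix x :: "nat \<Rightarrow> real" assume "norm_sq d x \<le> 1"
      then have "\<bar>x i\<bar> \<le> 1" if "i < d" for i
        using abs_le_of_norm_sq[of d x 1 i] that by simp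
      then show "x \<in> cube d"
        by (auto simp: cube_def abs_le_iff minus_le_iff)
    qed
  qed simp
  also have "\<dots> < \<infinity>"
    unfolding emeasure_leb_cube by (induction d) (auto simp: ennreal_mult_less_top)
  finally show ?thesis .
qed

text \<open>The cube of half side \<open>1 / sqrt d\<close> is inscribed in the ball. This crude
  bound is enough for \<open>lower_bound_constant\<close>.\<close>

lemma emeasure_ball_lower:
  assumes "d > 0"
  shows "emeasure (leb d) {x. norm_sq d x \<le> 1} \<ge> ennreal ((2 / sqrt d) ^ d)"
proof -
  have "ennreal ((2 / sqrt d) ^ d) = (\<Prod>i<d. ennreal (1 / sqrt d - - (1 / sqrt d)))"
    by (simp add: ennreal_power)
  also have "\<dots> = emeasure (leb d) {x. \<forall>i<d. - (1 / sqrt d) \<le> x i \<and> x i \<le> 1 / sqrt d}"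
    by (rule emeasure_leb_box[symmetric]) (simp add: order.trans[of _ 0])
  also have "\<dots> \<le> emeasure (leb d) {x. norm_sq d x \<le> 1}"
  proof (rule emeasure_mono)
    show "{x. \<forall>i<d. - (1 / sqrt d) \<le> x i \<and> x i \<le> 1 / sqrt d} \<subseteq> {x. norm_sq d x \<le> 1}"
    proof safe
      fix x :: "nat \<Rightarrow> real" assume "\<forall>i<d. - (1 / sqrt d) \<le> x i \<and> x i \<le> 1 / sqrt d"
      then have "norm_sq d x \<le> real d * (1 / sqrt d)\<^sup>2"
        by (intro norm_sq_le_of_abs) (auto simp: abs_le_iff minus_le_iff)
      then show "norm_sq d x \<le> 1" using assms by (simp add: power_divide)
    qed
  qed simp
  finally show ?thesis .
qed

section \<open>Hadamard's inequality\<close>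

text \<open>Expansion along the Gram matrix of the columns. The mixed terms are kept apart since
  they will integrate to 0.\<close>

lemma norm_sq_col_comb:
  "norm_sq d (col_comb d q x) = (\<Sum>j<d. norm_sq d (q j) * (x j)\<^sup>2) +
     (\<Sum>j<d. \<Sum>k\<in>{..<d} - {j}. x j * x k * (\<Sum>i<d. q j i * q k i))"
proof -
  have "norm_sq d (col_comb d q x) = (\<Sum>i<d. \<Sum>j<d. \<Sum>k<d. x j * x k * (q j i * q k i))"
    by (simp add: norm_sq_def col_comb_def power2_eq_square sum_product mult_ac)
  also have "\<dots> = (\<Sum>j<d. \<Sum>i<d. \<Sum>k<d. x j * x k * (q j i * q k i))"
    by (rule sum.swap)
  also have "\<dots> = (\<Sum>j<d. \<Sum>k<d. \<Sum>i<d. x j * x k * (q j i * q k i))"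
    by (intro sum.cong refl sum.swap)
  also have "\<dots> = (\<Sum>j<d. \<Sum>k<d. x j * x k * (\<Sum>i<d. q j i * q k i))"
    by (simp add: sum_distrib_left)
  also have "\<dots> = (\<Sum>j<d. norm_sq d (q j) * (x j)\<^sup>2 +
      (\<Sum>k\<in>{..<d} - {j}. x j * x k * (\<Sum>i<d. q j i * q k i)))"
    by (intro sum.cong refl, subst sum.remove)
       (auto simp: norm_sq_def power2_eq_square mult_ac)
  finally show ?thesis
    by (simp add: sum.distrib)
qed

text \<open>A zero column would send the unit vector \<open>e\<close> to 0, against the left
  inverse.\<close>

lemma norm_sq_column_pos:
  assumes "inverse_cols d q q'" "j < d"
  shows "norm_sq d (q j) > 0"
proof (rule ccontr)
  assume "\<not> norm_sq d (q j) > 0"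
  then have "norm_sq d (q j) = 0"
    using sum_nonneg[of "{..<d}" "\<lambda>i. (q j i)\<^sup>2"] by (simp add: norm_sq_def)
  then have "\<forall>i<d. q j i = 0"
    by (simp add: norm_sq_def sum_nonneg_eq_0_iff)
  moreover have "\<forall>i\<ge>d. q j i = 0"
    using assms by (auto simp: inverse_cols_def vec_space_iff)
  ultimately have q: "q j i = 0" for i
    by (cases "i < d") auto
  define e :: "nat \<Rightarrow> real" where "e = (\<lambda>i. if i = j then 1 else 0)"
  have "e \<in> vec_space d"
    using assms(2) by (auto simp: e_def vec_space_iff)
  then have "col_comb d q' (col_comb d q e) = e"
    using assms(1) by (auto simp: inverse_cols_def)
  moreover have "e k * q k i = 0" for k i
    using q by (auto simp: e_def)
  then have "col_comb d q e = (\<lambda>i. 0)"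
    unfolding col_comb_def by (intro ext sum.neutral) auto
  then have "col_comb d q' (col_comb d q e) j = 0"
    by (simp add: col_comb_def)
  ultimately show False
    by (simp add: e_def)
qed

text \<open>
  The tent function \<open>f x = max 0 (1 - \<bar>x\<bar>\<^sup>2)\<close> is a convex function of \<open>\<bar>x\<bar>\<^sup>2\<close>,
  so \<open>f (Q x) - f (R x)\<close> is at least \<open>\<bar>R x\<bar>\<^sup>2 - \<bar>Q x\<bar>\<^sup>2\<close> on \<open>{x. \<bar>R x\<bar> \<le> 1}\<close> and nonnegative off this
  set, where \<open>R\<close> is the diagonal matrix of the column lengths of \<open>Q\<close>. The difference
  \<open>\<bar>R x\<bar>\<^sup>2 - \<bar>Q x\<bar>\<^sup>2\<close> has only mixed terms, whose integrals vanish by the sign symmetries of \<open>\<bar>R x\<bar>\<close>.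
\<close>

lemma vimage_factor_hadamard:
  assumes ip: "inverse_cols d q q'"
  shows "vimage_factor d q' \<le> (\<Prod>j<d. ennreal (sqrt (norm_sq d (q j))))"
proof -
  define r where "r j = sqrt (norm_sq d (q j))" for j
  have rpos: "r j > 0" if "j < d" for j
    using norm_sq_column_pos[OF ip that] by (simp add: r_def)
  have ipr: "inverse_cols d (diag_cols d r) (diag_cols d (\<lambda>i. 1 / r i))"
    using rpos by (intro inverse_cols_diag) force
  define f :: "(nat \<Rightarrow> real) \<Rightarrow> real" where "f x = max 0 (1 - norm_sq d x)" for x
  have f_meas [measurable]: "f \<in> borel_measurable borel"
    unfolding f_def by measurable
  have f_bds: "0 \<le> f x" "f x \<le> 1" for x
    using sum_nonneg[of "{..<d}" "\<lambda>i. (x i)\<^sup>2"] by (auto simp: f_def norm_sq_def)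
  define g where "g j k = (\<Sum>i<d. q j i * q k i)" for j k
  define W where "W = {x. norm_sq d (col_comb d (diag_cols d r) x) \<le> 1}"
  have W_meas [measurable]: "W \<in> sets borel"
    unfolding W_def by measurable
  have norm_sq_R: "norm_sq d (col_comb d (diag_cols d r) x) = (\<Sum>j<d. norm_sq d (q j) * (x j)\<^sup>2)" for x
    by (auto simp: norm_sq_def[of d "col_comb d (diag_cols d r) x"] col_comb_diag power_mult_distrib r_def norm_sq_def sum_nonneg)
  have fin: "emeasure (leb d) {x. norm_sq d (col_comb d a x) \<le> 1} < \<infinity>" if "inverse_cols d a a'" for a a'
  proof -
    have "emeasure (leb d) {x. col_comb d a x \<in> {y. norm_sq d y \<le> 1}} = vimage_factor d a * emeasure (leb d) {y. norm_sq d y \<le> 1}"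
      by (rule emeasure_col_comb_vimage[OF that]) simp
    moreover have "vimage_factor d a \<noteq> \<infinity>"
    proof
      assume "vimage_factor d a = \<infinity>"
      \<comment> \<open>In the extended nonnegative reals a product with infinity is 0 or infinity,
        never 1.\<close>
      then have "vimage_factor d a' * \<infinity> = 1"
        using vimage_factor_inverse[OF that] by (simp add: mult.commute)
      then show False
        by (auto simp: ennreal_mult_top split: if_splits)
    qed
    ultimately show ?thesis
      using emeasure_ball_finite[of d] by (auto simp: ennreal_mult_less_top less_top)
  qed
  have int_f: "integrable (leb d) (\<lambda>x. f (col_comb d a x))" if "inverse_cols d a a'" for a a'
  proof -
    have "integrable (leb d) (\<lambda>x. indicator {x. norm_sq d (col_comb d a x) \<le> 1} x *\<^sub>R f (col_comb d a x))"
      using fin[OF that] f_bds by (intro integrableI_bounded_set_indicator[where B = 1]) auto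
    also have "(\<lambda>x. indicator {x. norm_sq d (col_comb d a x) \<le> 1} x *\<^sub>R f (col_comb d a x)) = (\<lambda>x. f (col_comb d a x))"
      by (auto simp: fun_eq_iff indicator_def f_def)
    finally show ?thesis .
  qed
  have int_W: "integrable (leb d) (\<lambda>x. indicator W x *\<^sub>R (x j * x k))" if "j < d" "k < d" for j k
  proof (rule integrableI_bounded_set_indicator[where B = "(1 / r j) * (1 / r k)"])
    show "emeasure (leb d) W < \<infinity>"
      unfolding W_def by (rule fin[OF ipr])
    have bd: "\<bar>x i\<bar> \<le> 1 / r i" if "x \<in> W" "i < d" for x i
    proof -
      have "\<bar>r i * x i\<bar> \<le> 1"
        using abs_le_of_norm_sq[of d "col_comb d (diag_cols d r) x" 1 i] that by (simp add: W_def col_comb_diag)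
      then show ?thesis
        using rpos[OF that(2)] by (simp add: abs_mult field_simps)
    qed
    have "norm (x j * x k) \<le> (1 / r j) * (1 / r k)" if "x \<in> W" for x
      unfolding real_norm_def abs_mult
      using bd[OF that \<open>j < d\<close>] bd[OF that \<open>k < d\<close>] rpos[OF \<open>j < d\<close>] by (intro mult_mono) auto
    then show "AE x in leb d. x \<in> W \<longrightarrow> norm (x j * x k) \<le> (1 / r j) * (1 / r k)"
      by simp
  qed auto
  have zero_W: "(\<integral>x. indicator W x *\<^sub>R (x j * x k) \<partial>leb d) = 0" if "j < d" "k < d" "k \<noteq> j" for j k
  proof -
    \<comment> \<open>Flipping the sign of coordinate \<open>j\<close> preserves \<open>W\<close>
      and the measure but negates the integrand.\<close>
    define s :: "nat \<Rightarrow> real" where "s i = (if i = j then - 1 else 1)" for i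
    define p :: "(nat \<Rightarrow> real) \<Rightarrow> real" where "p x = indicator W x *\<^sub>R (x j * x k)" for x
    have [measurable]: "p \<in> borel_measurable borel"
      unfolding p_def by measurable
    have "(\<Sum>i<d. norm_sq d (q i) * (col_comb d (diag_cols d s) x i)\<^sup>2) = (\<Sum>i<d. norm_sq d (q i) * (x i)\<^sup>2)" for x
      by (intro sum.cong) (auto simp: col_comb_diag s_def)
    then have "col_comb d (diag_cols d s) x \<in> W \<longleftrightarrow> x \<in> W" for x
      by (simp add: W_def norm_sq_R)
    then have "p (col_comb d (diag_cols d s) x) = - p x" for x
      using that by (auto simp: p_def indicator_def col_comb_diag s_def)
    moreover have "(\<integral>x. p (col_comb d (diag_cols d s) x) \<partial>leb d) = (\<integral>x. p x \<partial>leb d)"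
      by (rule integral_leb_flip) (auto simp: s_def)
    ultimately have "(\<integral>x. p x \<partial>leb d) = 0"
      by simp
    then show ?thesis by (simp add: p_def)
  qed
  define u where "u j k x = indicator W x *\<^sub>R (x j * x k)" for j k and x :: "nat \<Rightarrow> real"
  have u: "integrable (leb d) (u j k)" "j \<noteq> k \<Longrightarrow> (\<integral>x. u j k x \<partial>leb d) = 0"
    if "j < d" "k < d" for j k
    using int_W[OF that] zero_W[of j k] that unfolding u_def by auto
  \<comment> \<open>The mixed part of \<open>|Q x|^2\<close> cut off to \<open>W\<close>. The
    cut-off makes it integrable and leaves its integral 0.\<close>
  define G where "G x = (\<Sum>j<d. \<Sum>k\<in>{..<d} - {j}. g j k * u j k x)" for x
  have G: "integrable (leb d) G" "(\<integral>x. G x \<partial>leb d) = 0"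
  proof -
    have row: "integrable (leb d) (\<lambda>x. \<Sum>k\<in>{..<d} - {j}. g j k * u j k x)" if "j < d" for j
      using u that by (intro Bochner_Integration.integrable_sum) auto
    then show "integrable (leb d) G"
      unfolding G_def by (rule Bochner_Integration.integrable_sum) auto
    have "(\<integral>x. G x \<partial>leb d) = (\<Sum>j<d. \<integral>x. (\<Sum>k\<in>{..<d} - {j}. g j k * u j k x) \<partial>leb d)"
      unfolding G_def using row by (intro Bochner_Integration.integral_sum) auto
    also have "\<dots> = (\<Sum>j<d. \<Sum>k\<in>{..<d} - {j}. \<integral>x. g j k * u j k x \<partial>leb d)"
      using u by (intro sum.cong refl Bochner_Integration.integral_sum) auto
    also have "\<dots> = 0"
      using u by (intro sum.neutral ballI) auto
    finally show "(\<integral>x. G x \<partial>leb d) = 0" .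
  qed
  have G_eq: "G x = (if x \<in> W then norm_sq d (col_comb d q x) - norm_sq d (col_comb d (diag_cols d r) x) else 0)" for x
    by (auto simp: G_def u_def norm_sq_col_comb[of d q x] norm_sq_R g_def mult_ac)
  \<comment> \<open>On \<open>W\<close> the left side is \<open>1 - |Q x|^2\<close>; off
    \<open>W\<close> both of its terms vanish.\<close>
  have "f (col_comb d (diag_cols d r) x) - G x \<le> f (col_comb d q x)" for x
    unfolding G_eq by (auto simp: f_def W_def)
  then have "(\<integral>x. f (col_comb d (diag_cols d r) x) - G x \<partial>leb d) \<le> (\<integral>x. f (col_comb d q x) \<partial>leb d)"
    using int_f[OF ip] int_f[OF ipr] G by (intro integral_mono) auto
  then have "(\<integral>x. f (col_comb d (diag_cols d r) x) \<partial>leb d) \<le> (\<integral>x. f (col_comb d q x) \<partial>leb d)"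
    using int_f[OF ipr] G by simp
  then have "(\<integral>\<^sup>+x. f (col_comb d (diag_cols d r) x) \<partial>leb d) \<le> (\<integral>\<^sup>+x. f (col_comb d q x) \<partial>leb d)"
    using f_bds by (simp add: nn_integral_eq_integral int_f[OF ip] int_f[OF ipr] ennreal_leI)
  then have le: "vimage_factor d (diag_cols d r) * (\<integral>\<^sup>+x. f x \<partial>leb d) \<le> vimage_factor d q * (\<integral>\<^sup>+x. f x \<partial>leb d)"
    using nn_integral_col_comb[OF ip, of "\<lambda>x. ennreal (f x)"] nn_integral_col_comb[OF ipr, of "\<lambda>x. ennreal (f x)"]
    by simp
  \<comment> \<open>The common integral of \<open>f\<close> is to be cancelled, so it has to be
    nonzero and finite. The half side \<open>1 / (real d + 1)\<close> keeps the estimate below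
    strict also for \<open>d = 1\<close>.\<close>
  have I0: "(\<integral>\<^sup>+x. f x \<partial>leb d) \<noteq> 0"
  proof
    assume "(\<integral>\<^sup>+x. f x \<partial>leb d) = 0"
    then have "AE x in leb d. ennreal (f x) = 0"
      by (subst (asm) nn_integral_0_iff_AE) auto
    then have "emeasure (leb d) {x. f x > 0} = 0"
      by (subst (asm) AE_iff_measurable[of "{x. f x > 0}"]) (use f_bds in \<open>auto simp: ennreal_eq_0_iff not_le\<close>)
    moreover have "emeasure (leb d) {x. \<forall>i<d. - (1 / (real d + 1)) \<le> x i \<and> x i \<le> 1 / (real d + 1)} \<le>
        emeasure (leb d) {x. f x > 0}"
    proof (rule emeasure_mono)
      show "{x. \<forall>i<d. - (1 / (real d + 1)) \<le> x i \<and> x i \<le> 1 / (real d + 1)} \<subseteq> {x. f x > 0}"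
      proof safe
        fix x :: "nat \<Rightarrow> real" assume "\<forall>i<d. - (1 / (real d + 1)) \<le> x i \<and> x i \<le> 1 / (real d + 1)"
        then have "norm_sq d x \<le> real d * (1 / (real d + 1))\<^sup>2"
          by (intro norm_sq_le_of_abs) (auto simp: abs_le_iff minus_le_iff)
        also have "\<dots> < 1"
          by (simp add: power_divide divide_simps) (simp add: power2_eq_square algebra_simps add_pos_nonneg)
        finally show "f x > 0" by (simp add: f_def)
      qed
    qed simp
    moreover have "emeasure (leb d) {x. \<forall>i<d. - (1 / (real d + 1)) \<le> x i \<and> x i \<le> 1 / (real d + 1)} =
        (\<Prod>i<d. ennreal (1 / (real d + 1) - - (1 / (real d + 1))))"
      by (rule emeasure_leb_box) (simp add: order.trans[of _ 0])
    moreover have "\<dots> \<noteq> 0"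
      by (auto simp: ennreal_eq_0_iff not_le)
    ultimately show False by simp
  qed
  have I1: "(\<integral>\<^sup>+x. f x \<partial>leb d) \<noteq> \<infinity>"
  proof -
    have "(\<integral>\<^sup>+x. f x \<partial>leb d) \<le> (\<integral>\<^sup>+x. indicator {x. norm_sq d x \<le> 1} x \<partial>leb d)"
      using f_bds by (intro nn_integral_mono) (auto simp: indicator_def f_def ennreal_le_1)
    also have "\<dots> = emeasure (leb d) {x. norm_sq d x \<le> 1}"
      by (rule nn_integral_indicator) simp
    also have "\<dots> < \<infinity>" by (rule emeasure_ball_finite)
    finally show ?thesis by simp
  qed
  have "vimage_factor d (diag_cols d r) \<le> vimage_factor d q"
  proof -
    let ?F = "\<integral>\<^sup>+x. f x \<partial>leb d"
    have "vimage_factor d (diag_cols d r) * ?F / ?F \<le> vimage_factor d q * ?F / ?F"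
      by (rule divide_right_mono_ennreal[OF le])
    then show ?thesis
      using I0 I1 by (simp add: ennreal_mult_divide_eq)
  qed
  \<comment> \<open>Multiplying by the factors of both inverses cancels one factor on each side and
    passes from \<open>q\<close> to \<open>q'\<close>.\<close>
  then have "vimage_factor d (diag_cols d r) * (vimage_factor d q' * vimage_factor d (diag_cols d (\<lambda>i. 1 / r i))) \<le>
      vimage_factor d q * (vimage_factor d q' * vimage_factor d (diag_cols d (\<lambda>i. 1 / r i)))"
    by (rule mult_right_mono) simp
  then have "vimage_factor d q' \<le> vimage_factor d (diag_cols d (\<lambda>i. 1 / r i))"
    using vimage_factor_inverse[OF ip] vimage_factor_inverse[OF ipr]
    by (metis mult.assoc mult.commute mult_1)
  also have "\<dots> = (\<Prod>j<d. ennreal (r j))"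
    using rpos by (subst vimage_factor_diag) auto
  finally show ?thesis
    by (simp add: r_def)
qed

text \<open>Here \<open>vimage_factor d p'\<close> is \<open>|det p| = |det t| |det (t' p)|\<close>.
  Hadamard's inequality is applied to \<open>t' p\<close>, so lengths are measured in the
  coordinates in which the ellipsoid is a ball.\<close>

lemma emeasure_simplex_le:
  assumes t: "inverse_cols d t t'" and p: "inverse_cols d p p'"
  shows "emeasure (leb d) {x. col_comb d p' x \<in> {x. (\<forall>i<d. 0 \<le> x i) \<and> (\<Sum>i<d. x i) \<le> 1}} \<le>
    vimage_factor d t' * (\<Prod>j<d. ennreal (sqrt (norm_sq d (col_comb d t' (p j))))) * ennreal (1 / fact d)"
proof -
  have "vimage_factor d p' = vimage_factor d t' * (vimage_factor d p' * vimage_factor d t)"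
    using vimage_factor_inverse[OF t] by (metis mult.assoc mult.commute mult_1)
  also have "vimage_factor d p' * vimage_factor d t = vimage_factor d (comp_cols d p' t)"
    using vimage_factor_comp[OF inverse_cols_sym[OF p] t] ..
  also have "\<dots> \<le> (\<Prod>j<d. ennreal (sqrt (norm_sq d (comp_cols d t' p j))))"
    by (rule vimage_factor_hadamard[OF inverse_cols_comp[OF inverse_cols_sym[OF t] p]])
  finally have "vimage_factor d p' \<le> vimage_factor d t' * (\<Prod>j<d. ennreal (sqrt (norm_sq d (comp_cols d t' p j))))"
    by (simp add: mult_left_mono)
  moreover have "emeasure (leb d) {x. col_comb d p' x \<in> {x. (\<forall>i<d. 0 \<le> x i) \<and> (\<Sum>i<d. x i) \<le> 1}} =
      vimage_factor d p' * ennreal (1 / fact d)"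
    by (subst emeasure_col_comb_vimage[OF inverse_cols_sym[OF p]]) (auto simp: emeasure_leb_simplex)
  ultimately show ?thesis
    by (simp add: comp_cols_def mult_right_mono)
qed

section \<open>Linear algebra and symmetric polynomials\<close>

lemma sum_fun_apply: "(\<Sum>k\<in>A. f k) i = (\<Sum>k\<in>A. f k i :: real)"
  by (induction A rule: infinite_finite_induct) auto

lemma col_comb_eq_sum: "col_comb d q x = (\<Sum>j<d. x j *\<^sub>R q j)"
  by (auto simp: col_comb_def fun_eq_iff sum_fun_apply scaleR_fun_def)

lemma subspace_vec_space: "subspace (vec_space d)"
  by (auto simp: subspace_def vec_space_iff scaleR_fun_def)

lemma col_comb_scaleR: "col_comb d q (c *\<^sub>R x) = c *\<^sub>R col_comb d q x"
  by (auto simp: col_comb_def fun_eq_iff scaleR_fun_def sum_distrib_left mult_ac)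

lemma col_comb_diff: "col_comb d q (x - y) = col_comb d q x - col_comb d q y"
  by (auto simp: col_comb_def fun_eq_iff algebra_simps sum_subtractf)

definition std_unit :: "nat \<Rightarrow> nat \<Rightarrow> real"
  where "std_unit k = (\<lambda>i. if i = k then 1 else 0)"

lemma col_comb_unit: "x \<in> vec_space d \<Longrightarrow> col_comb d std_unit x = x"
  by (auto simp: col_comb_def std_unit_def fun_eq_iff vec_space_iff if_distrib[of "\<lambda>y. _ * y"] cong: if_cong)

lemma std_unit_in_vec_space: "k < d \<Longrightarrow> std_unit k \<in> vec_space d"
  by (auto simp: std_unit_def vec_space_iff)

lemma inj_std_unit: "inj_on std_unit A"
  by (auto simp: inj_on_def std_unit_def fun_eq_iff split: if_splits)

lemma span_std_unit: "span (std_unit ` {..<d}) = vec_space d"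
proof
  show "span (std_unit ` {..<d}) \<subseteq> vec_space d"
    using std_unit_in_vec_space by (intro span_minimal subspace_vec_space) auto
  show "vec_space d \<subseteq> span (std_unit ` {..<d})"
  proof
    fix x assume "x \<in> vec_space d"
    then have "x = (\<Sum>j<d. x j *\<^sub>R std_unit j)"
      using col_comb_unit[of x d] by (simp add: col_comb_eq_sum)
    also have "\<dots> \<in> span (std_unit ` {..<d})"
      by (intro span_sum span_scale span_base) auto
    finally show "x \<in> span (std_unit ` {..<d})" .
  qed
qed

lemma independent_std_unit: "independent (std_unit ` {..<d})"
proof
  assume "dependent (std_unit ` {..<d})"
  then obtain u where u: "\<exists>v\<in>std_unit ` {..<d}. u v \<noteq> 0" "(\<Sum>v\<in>std_unit ` {..<d}. u v *\<^sub>R v) = 0"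
    by (subst (asm) dependent_finite) auto
  have "(\<Sum>k<d. u (std_unit k) *\<^sub>R std_unit k) = 0"
    using u(2) by (subst (asm) sum.reindex) (auto simp: inj_std_unit)
  then have "(\<Sum>k<d. u (std_unit k) *\<^sub>R std_unit k) i = 0" for i
    by simp
  then have "(\<Sum>k<d. u (std_unit k) * std_unit k i) = 0" for i
    by (simp add: sum_fun_apply scaleR_fun_def)
  then have *: "(\<Sum>k<d. if i = k then u (std_unit k) else 0) = 0" for i
    by (simp add: std_unit_def if_distrib[of "\<lambda>y. _ * y"] cong: if_cong)
  then have "u (std_unit i) = 0" if "i < d" for i
    using *[of i] that by simp
  then show False using u(1) by auto
qed

lemma card_spanning_ge:
  assumes "finite S" "vec_space d \<subseteq> span S"
  shows "d \<le> card S"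
proof -
  have "std_unit ` {..<d} \<subseteq> span S"
    using assms(2) std_unit_in_vec_space by auto
  from independent_span_bound[OF assms(1) independent_std_unit this]
  show ?thesis by (simp add: card_image inj_std_unit)
qed

text \<open>Preimages of the unit vectors are the columns of a right inverse. It is also a left
  inverse: a nonzero kernel vector would express one column by the others, and fewer than
  \<open>d\<close> vectors would span \<open>vec_space d\<close>.\<close>

lemma inverse_cols_of_span:
  assumes p: "\<And>j. j < d \<Longrightarrow> p j \<in> vec_space d" and span: "vec_space d \<subseteq> span (p ` {..<d})"
  shows "\<exists>p'. inverse_cols d p p'"
proof -
  have "subspace (col_comb d p ` vec_space d)"
    unfolding subspace_def
  proof (intro conjI ballI allI)
    show "0 \<in> col_comb d p ` vec_space d"
      by (rule image_eqI[of _ _ 0]) (auto simp: vec_space_iff col_comb_def fun_eq_iff)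
    show "x + y \<in> col_comb d p ` vec_space d" if "x \<in> col_comb d p ` vec_space d" "y \<in> col_comb d p ` vec_space d" for x y
      using that subspace_add[OF subspace_vec_space] by (auto simp: col_comb_add[symmetric])
    show "c *\<^sub>R x \<in> col_comb d p ` vec_space d" if "x \<in> col_comb d p ` vec_space d" for x c
      using that subspace_scale[OF subspace_vec_space] by (auto simp: col_comb_scaleR[symmetric])
  qed
  moreover have "p ` {..<d} \<subseteq> col_comb d p ` vec_space d"
  proof safe
    fix j assume j: "j < d"
    have "p j = col_comb d p (std_unit j)"
      using j by (auto simp: col_comb_def std_unit_def fun_eq_iff if_distrib[of "\<lambda>y. y * _"] cong: if_cong)
    then show "p j \<in> col_comb d p ` vec_space d"
      using std_unit_in_vec_space[OF j] by auto
  qed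
  ultimately have "vec_space d \<subseteq> col_comb d p ` vec_space d"
    using span span_minimal by blast
  then have "\<forall>k. k < d \<longrightarrow> (\<exists>y. y \<in> vec_space d \<and> col_comb d p y = std_unit k)"
    using std_unit_in_vec_space by (metis (no_types, lifting) imageE subsetD)
  then obtain p' where p': "\<And>k. k < d \<Longrightarrow> p' k \<in> vec_space d \<and> col_comb d p (p' k) = std_unit k"
    by metis
  have right: "col_comb d p (col_comb d p' x) = x" if "x \<in> vec_space d" for x
  proof -
    have "col_comb d p (col_comb d p' x) = col_comb d (comp_cols d p p') x"
      by (simp add: col_comb_comp)
    also have "\<dots> = col_comb d std_unit x"
      using p' by (simp add: col_comb_eq_sum[of d _ x] comp_cols_def)
    finally show ?thesis using that by (simp add: col_comb_unit)
  qed
  have inj: "x = 0" if x: "x \<in> vec_space d" "col_comb d p x = 0" for x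
  proof (rule ccontr)
    assume "x \<noteq> 0"
    then obtain j where j: "x j \<noteq> 0" by (auto simp: fun_eq_iff)
    then have jd: "j < d"
      using x(1) by (metis vec_space_iff not_le)
    let ?S = "p ` ({..<d} - {j})"
    have "x j *\<^sub>R p j + (\<Sum>i\<in>{..<d} - {j}. x i *\<^sub>R p i) = 0"
      using x(2) jd by (simp add: col_comb_eq_sum sum.remove)
    then have "x j *\<^sub>R p j = - (\<Sum>i\<in>{..<d} - {j}. x i *\<^sub>R p i)"
      by (simp add: eq_neg_iff_add_eq_0)
    also have "\<dots> \<in> span ?S"
      by (intro span_neg span_sum span_scale span_base) auto
    finally have "(1 / x j) *\<^sub>R (x j *\<^sub>R p j) \<in> span ?S"
      by (rule span_scale)
    then have "p j \<in> span ?S"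
      using j by simp
    moreover have "p i \<in> span ?S" if "i < d" "i \<noteq> j" for i
      using that by (intro span_base) auto
    ultimately have "p ` {..<d} \<subseteq> span ?S"
      by auto
    then have "vec_space d \<subseteq> span ?S"
      using span span_minimal[OF _ subspace_span] by blast
    then have "d \<le> card ?S"
      by (intro card_spanning_ge) auto
    also have "\<dots> \<le> card ({..<d} - {j})"
      by (rule card_image_le) auto
    finally show False using jd by simp
  qed
  have left: "col_comb d p' (col_comb d p x) = x" if "x \<in> vec_space d" for x
  proof -
    have V: "col_comb d p x \<in> vec_space d" "col_comb d p' y \<in> vec_space d" for x y
      using p p' by (auto intro: col_comb_in_vec_space)
    have "col_comb d p (col_comb d p' (col_comb d p x) - x) = 0"
      by (simp add: col_comb_diff right V)
    then have "col_comb d p' (col_comb d p x) - x = 0"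
      by (rule inj[OF subspace_diff[OF subspace_vec_space V(2) that]])
    then show ?thesis by simp
  qed
  have "inverse_cols d p p'"
    unfolding inverse_cols_def using p p' right left by simp
  then show ?thesis by (intro exI[of _ p'])
qed

section \<open>Caratheodory's theorem for cones and elementary symmetric polynomials\<close>

text \<open>Subtracting a multiple of a linear relation removes a point. Only the bound
  \<open>s\<close> on the total weight has to survive, not its value, so linear rather than affine
  independence is reached.\<close>

lemma conic_caratheodory:
  fixes P :: "'a::real_vector set"
  assumes "finite P" "\<And>p. p \<in> P \<Longrightarrow> 0 \<le> l p" "sum l P \<le> s" "x = (\<Sum>p\<in>P. l p *\<^sub>R p)"
  shows "\<exists>I m. I \<subseteq> P \<and> independent I \<and> (\<forall>p\<in>I. 0 \<le> m p) \<and> sum m I \<le> s \<and> x = (\<Sum>p\<in>I. m p *\<^sub>R p)"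
  using assms
proof (induction "card P" arbitrary: P l rule: less_induct)
  case less
  show ?case
  proof (cases "independent P")
    case True
    then show ?thesis using less.prems by blast
  next
    case False
    then obtain u0 where u0: "\<exists>v\<in>P. u0 v \<noteq> 0" "(\<Sum>v\<in>P. u0 v *\<^sub>R v) = 0"
      using dependent_finite[OF less.prems(1)] by auto
    \<comment> \<open>The sign of the relation is chosen so that subtracting it cannot increase the
      total weight.\<close>
    obtain u where u: "\<exists>v\<in>P. u v \<noteq> 0" "(\<Sum>v\<in>P. u v *\<^sub>R v) = 0" "sum u P \<ge> 0"
    proof (cases "sum u0 P \<ge> 0")
      case True
      then show ?thesis using u0 that by blast
    next
      case False
      then show ?thesis
        using u0 by (intro that[of "\<lambda>v. - u0 v"]) (auto simp: sum_negf)
    qed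
    define Q where "Q = {v\<in>P. u v > 0}"
    have "Q \<noteq> {}"
    proof
      assume "Q = {}"
      then have le: "u v \<le> 0" if "v \<in> P" for v
        using that by (auto simp: Q_def not_less)
      then have "sum u P \<le> 0" by (intro sum_nonpos) auto
      then have "sum u P = 0" using u(3) by simp
      then have "\<forall>v\<in>P. u v = 0"
        using sum_nonneg_eq_0_iff[of P "\<lambda>v. - u v"] le less.prems(1) by (simp add: sum_negf)
      then show False using u(1) by auto
    qed
    have finQ: "finite Q" using less.prems(1) by (simp add: Q_def)
    \<comment> \<open>The largest multiple of \<open>u\<close> that can be subtracted with all
      weights staying nonnegative; the weight of a minimiser \<open>w\<close> becomes 0.\<close>
    define t where "t = Min ((\<lambda>v. l v / u v) ` Q)"
    have "t \<in> (\<lambda>v. l v / u v) ` Q"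
      unfolding t_def using finQ \<open>Q \<noteq> {}\<close> by (intro Min_in) auto
    then obtain w where w: "w \<in> Q" "t = l w / u w" by auto
    have t0: "t \<ge> 0" using w less.prems(2) by (auto simp: Q_def)
    define l' where "l' v = l v - t * u v" for v
    have l'_nonneg: "l' v \<ge> 0" if "v \<in> P" for v
    proof (cases "v \<in> Q")
      case True
      then have "t \<le> l v / u v"
        unfolding t_def using finQ by (intro Min_le) auto
      then show ?thesis using True by (auto simp: l'_def Q_def field_simps)
    next
      case False
      then have "t * u v \<le> 0"
        using that t0 by (auto simp: Q_def mult_nonneg_nonpos)
      then show ?thesis using less.prems(2)[OF that] by (simp add: l'_def)
    qed
    have wP: "w \<in> P" and l'w: "l' w = 0"
      using w by (auto simp: Q_def l'_def)
    have "sum l' (P - {w}) = sum l' P"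
      using wP l'w less.prems(1) by (simp add: sum.remove)
    also have "\<dots> = sum l P - t * sum u P"
      by (simp add: l'_def sum_subtractf sum_distrib_left)
    also have "\<dots> \<le> s"
      using less.prems(3) t0 u(3) by (smt (verit) mult_nonneg_nonneg)
    finally have 1: "sum l' (P - {w}) \<le> s" .
    have "(\<Sum>p\<in>P - {w}. l' p *\<^sub>R p) = (\<Sum>p\<in>P. l' p *\<^sub>R p)"
      using wP l'w less.prems(1) by (simp add: sum.remove)
    also have "\<dots> = x - t *\<^sub>R (\<Sum>p\<in>P. u p *\<^sub>R p)"
      unfolding less.prems(4) by (simp add: l'_def scaleR_diff_left sum_subtractf scaleR_sum_right)
    finally have 2: "x = (\<Sum>p\<in>P - {w}. l' p *\<^sub>R p)"
      using u(2) by simp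
    have "card (P - {w}) < card P"
      using wP less.prems(1) by (intro psubset_card_mono) auto
    from less.hyps[OF this _ _ 1 2] l'_nonneg less.prems(1) show ?thesis
      by auto
  qed
qed

text \<open>Each product over a \<open>k\<close>-subset occurs \<open>fact k\<close> times in the
  expansion of \<open>(sum a P) ^ k\<close>. The induction avoids this count by splitting the
  subsets of \<open>insert x P\<close> according to whether they contain \<open>x\<close>.\<close>

lemma elementary_symmetric_le:
  fixes a :: "'a \<Rightarrow> real"
  assumes "finite P" "\<And>p. p \<in> P \<Longrightarrow> 0 \<le> a p"
  shows "(\<Sum>B | B \<subseteq> P \<and> card B = k. prod a B) \<le> (sum a P) ^ k / fact k"
  using assms
proof (induction P arbitrary: k rule: finite_induct)
  case empty
  have "{B::'a set. B = {} \<and> card B = k} = (if k = 0 then {{}} else {})" by auto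
  then show ?case by (cases k) (simp_all add: subset_empty)
next
  case (insert x P)
  have nn: "sum a P \<ge> 0" "a x \<ge> 0"
    using insert.prems by (auto intro: sum_nonneg)
  show ?case
  proof (cases k)
    case 0
    have "{B. B \<subseteq> insert x P \<and> card B = 0} = {{}}"
      using insert.hyps by (auto simp: card_eq_0_iff dest: finite_subset)
    then show ?thesis using 0 by simp
  next
    case (Suc m)
    let ?F = "\<lambda>P k. {B. B \<subseteq> P \<and> card B = k}"
    have fin: "finite (?F P k)" for k
      using insert.hyps by simp
    have finB: "finite B" if "B \<in> ?F P k" for B k
      using that insert.hyps by (auto dest: finite_subset)
    have eq: "?F (insert x P) k = ?F P k \<union> insert x ` ?F P m"
    proof (rule Set.set_eqI)
      fix B
      show "B \<in> ?F (insert x P) k \<longleftrightarrow> B \<in> ?F P k \<union> insert x ` ?F P m"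
      proof (cases "x \<in> B")
        case True
        then obtain C where C: "B = insert x C" "x \<notin> C" by (meson mk_disjoint_insert)
        have "B \<in> ?F (insert x P) k \<longleftrightarrow> C \<in> ?F P m"
        proof (cases "finite C")
          case True
          then show ?thesis using C Suc by auto
        next
          case False
          then show ?thesis using C Suc insert.hyps by (auto dest: finite_subset)
        qed
        also have "C \<in> ?F P m \<longleftrightarrow> B \<in> insert x ` ?F P m"
        proof
          assume "B \<in> insert x ` ?F P m"
          then obtain D where D: "D \<in> ?F P m" "B = insert x D" by auto
          then have "x \<notin> D" using insert.hyps by auto
          then have "C = D" using C D by auto
          then show "C \<in> ?F P m" using D by simp
        qed (use C in auto)
        finally show ?thesis using True insert.hyps by auto
      qed auto
    qed
    have inj: "inj_on (insert x) (?F P m)"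
      using insert.hyps by (auto simp: inj_on_def)
    have "(\<Sum>B\<in>?F (insert x P) k. prod a B) = (\<Sum>B\<in>?F P k. prod a B) + (\<Sum>B\<in>insert x ` ?F P m. prod a B)"
      unfolding eq using fin insert.hyps by (intro sum.union_disjoint) auto
    also have "(\<Sum>B\<in>insert x ` ?F P m. prod a B) = (\<Sum>B\<in>?F P m. prod a (insert x B))"
      by (subst sum.reindex[OF inj]) simp
    also have "\<dots> = (\<Sum>B\<in>?F P m. a x * prod a B)"
    proof (rule sum.cong)
      fix B assume B: "B \<in> ?F P m"
      then have "x \<notin> B" using insert.hyps by auto
      then show "prod a (insert x B) = a x * prod a B"
        by (rule prod.insert[OF finB[OF B]])
    qed simp
    also have "\<dots> = a x * (\<Sum>B\<in>?F P m. prod a B)"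
      by (simp add: sum_distrib_left)
    also have "(\<Sum>B\<in>?F P k. prod a B) + a x * (\<Sum>B\<in>?F P m. prod a B) \<le>
        (sum a P) ^ k / fact k + a x * ((sum a P) ^ m / fact m)"
      using insert nn by (intro add_mono mult_left_mono) auto
    also have "\<dots> = ((sum a P) ^ Suc m + real (Suc m) * a x * (sum a P) ^ m) / fact (Suc m)"
      unfolding Suc by (simp add: field_simps del: of_nat_Suc)
    also have "\<dots> \<le> (sum a P + a x) ^ Suc m / fact (Suc m)"
    proof (rule divide_right_mono)
      \<comment> \<open>The first two terms of the binomial expansion.\<close>
      have "s ^ Suc m + real (Suc m) * b * s ^ m \<le> (s + b) ^ Suc m" if "s \<ge> 0" "b \<ge> 0" for s b :: real
      proof (induction m)
        case (Suc m)
        have "s ^ Suc (Suc m) + real (Suc (Suc m)) * b * s ^ Suc m \<le>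
            (s + b) * (s ^ Suc m + real (Suc m) * b * s ^ m)"
          using that by (simp add: algebra_simps)
        also have "\<dots> \<le> (s + b) * (s + b) ^ Suc m"
          using that Suc by (intro mult_left_mono) auto
        finally show ?case by simp
      qed simp
      then show "(sum a P) ^ Suc m + real (Suc m) * a x * (sum a P) ^ m \<le> (sum a P + a x) ^ Suc m"
        using nn by blast
    qed simp
    finally show ?thesis
      using insert.hyps Suc by (simp add: add.commute)
  qed
qed

section \<open>Volume of a convex hull inside an ellipsoid\<close>

text \<open>\<open>S\<close> is the preimage of the standard simplex under the coordinate map of the
  basis \<open>B\<close>. It contains the simplex spanned by 0 and \<open>B\<close> and, being a
  preimage, is Borel.\<close>

lemma simplex_cover_piece:
  assumes t: "inverse_cols d t t'" and B: "finite B" "card B = d" "B \<subseteq> vec_space d" "vec_space d \<subseteq> span B"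
  shows "\<exists>S. S \<in> sets borel \<and>
    (\<forall>m. (\<forall>p\<in>B. 0 \<le> m p) \<and> sum m B \<le> 1 \<longrightarrow> (\<Sum>p\<in>B. m p *\<^sub>R p) \<in> S) \<and>
    emeasure (leb d) S \<le> vimage_factor d t' * ennreal ((\<Prod>p\<in>B. sqrt (norm_sq d (col_comb d t' p))) / fact d)"
proof -
  obtain b where b: "bij_betw b {..<d} B"
    using ex_bij_betw_nat_finite[OF B(1)] B(2) by (auto simp: atLeast0LessThan)
  then have bim: "b ` {..<d} = B" by (simp add: bij_betw_def)
  have "\<exists>b'. inverse_cols d b b'"
  proof (rule inverse_cols_of_span)
    show "b j \<in> vec_space d" if "j < d" for j
      using B(3) bim that by auto
    show "vec_space d \<subseteq> span (b ` {..<d})"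
      unfolding bim by (rule B(4))
  qed
  then obtain b' where b': "inverse_cols d b b'" ..
  define S where "S = {x. col_comb d b' x \<in> {x. (\<forall>i<d. 0 \<le> x i) \<and> (\<Sum>i<d. x i) \<le> 1}}"
  have 1: "S \<in> sets borel"
  proof -
    define A where "A = {x::nat\<Rightarrow>real. (\<forall>i<d. 0 \<le> x i) \<and> (\<Sum>i<d. x i) \<le> 1}"
    have [measurable]: "A \<in> sets borel"
      unfolding A_def by measurable
    have "{x. col_comb d b' x \<in> A} \<in> sets borel"
      by measurable
    then show ?thesis
      by (simp only: S_def A_def)
  qed
  have 2: "(\<Sum>p\<in>B. m p *\<^sub>R p) \<in> S" if m: "\<forall>p\<in>B. 0 \<le> m p" "sum m B \<le> 1" for m
  proof -
    define c where "c j = (if j < d then m (b j) else 0)" for j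
    have cV: "c \<in> vec_space d" by (auto simp: c_def vec_space_iff)
    have "(\<Sum>p\<in>B. m p *\<^sub>R p) = (\<Sum>j<d. m (b j) *\<^sub>R b j)"
      by (rule sum.reindex_bij_betw[OF b, symmetric])
    also have "\<dots> = col_comb d b c"
      by (simp add: col_comb_eq_sum c_def)
    finally have "col_comb d b' (\<Sum>p\<in>B. m p *\<^sub>R p) = c"
      using b' cV by (simp add: inverse_cols_def)
    moreover have "sum c {..<d} = (\<Sum>j<d. m (b j))"
      by (simp add: c_def)
    then have "sum c {..<d} = sum m B"
      using sum.reindex_bij_betw[OF b, of m] by simp
    moreover have "0 \<le> c i" for i
      using m bim by (auto simp: c_def)
    ultimately show ?thesis
      using m by (simp add: S_def)
  qed
  have "emeasure (leb d) S \<le> vimage_factor d t' * (\<Prod>j<d. ennreal (sqrt (norm_sq d (col_comb d t' (b j))))) * ennreal (1 / fact d)"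
    unfolding S_def by (rule emeasure_simplex_le[OF t b'])
  also have "(\<Prod>j<d. ennreal (sqrt (norm_sq d (col_comb d t' (b j))))) = ennreal (\<Prod>j<d. sqrt (norm_sq d (col_comb d t' (b j))))"
    by (rule prod_ennreal) (auto simp: norm_sq_def sum_nonneg)
  also have "(\<Prod>j<d. sqrt (norm_sq d (col_comb d t' (b j)))) = (\<Prod>p\<in>B. sqrt (norm_sq d (col_comb d t' p)))"
    by (rule prod.reindex_bij_betw[OF b])
  also have "vimage_factor d t' * ennreal (\<Prod>p\<in>B. sqrt (norm_sq d (col_comb d t' p))) * ennreal (1 / fact d) =
      vimage_factor d t' * ennreal ((\<Prod>p\<in>B. sqrt (norm_sq d (col_comb d t' p))) / fact d)"
    by (subst mult.assoc, subst ennreal_mult[symmetric]) (auto simp: norm_sq_def sum_nonneg intro!: prod_nonneg)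
  finally show ?thesis
    using 1 2 by blast
qed

text \<open>One factor \<open>fact d\<close> comes from the volume of each simplex, the other from
  the bound on the sum of the products over all bases.\<close>

lemma emeasure_convex_hull_le:
  assumes t: "inverse_cols d t t'" and P: "finite P" "P \<subseteq> vec_space d" "vec_space d \<subseteq> span P"
    and K: "K \<subseteq> convex hull P"
  shows "emeasure (leb d) K \<le> vimage_factor d t' * ennreal ((\<Sum>p\<in>P. sqrt (norm_sq d (col_comb d t' p))) ^ d / (fact d)\<^sup>2)"
proof -
  define a where "a p = sqrt (norm_sq d (col_comb d t' p))" for p
  have a0: "a p \<ge> 0" for p by (auto simp: a_def norm_sq_def sum_nonneg)
  define BB where "BB = {B. B \<subseteq> P \<and> card B = d \<and> vec_space d \<subseteq> span B}"
  have finBB: "finite BB" unfolding BB_def using P(1) by simp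
  have "\<forall>B\<in>BB. \<exists>S. S \<in> sets borel \<and>
      (\<forall>m. (\<forall>p\<in>B. 0 \<le> m p) \<and> sum m B \<le> 1 \<longrightarrow> (\<Sum>p\<in>B. m p *\<^sub>R p) \<in> S) \<and>
      emeasure (leb d) S \<le> vimage_factor d t' * ennreal ((\<Prod>p\<in>B. a p) / fact d)"
    unfolding a_def
  proof
    fix B assume "B \<in> BB"
    then have B: "B \<subseteq> P" "card B = d" "vec_space d \<subseteq> span B" by (auto simp: BB_def)
    show "\<exists>S. S \<in> sets borel \<and>
      (\<forall>m. (\<forall>p\<in>B. 0 \<le> m p) \<and> sum m B \<le> 1 \<longrightarrow> (\<Sum>p\<in>B. m p *\<^sub>R p) \<in> S) \<and>
      emeasure (leb d) S \<le> vimage_factor d t' * ennreal ((\<Prod>p\<in>B. sqrt (norm_sq d (col_comb d t' p))) / fact d)"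
      using B(1) P(2) by (intro simplex_cover_piece[OF t finite_subset[OF B(1) P(1)] B(2) _ B(3)]) simp
  qed
  from bchoice[OF this] obtain S where S0: "\<forall>B\<in>BB. S B \<in> sets borel \<and>
      (\<forall>m. (\<forall>p\<in>B. 0 \<le> m p) \<and> sum m B \<le> 1 \<longrightarrow> (\<Sum>p\<in>B. m p *\<^sub>R p) \<in> S B) \<and>
      emeasure (leb d) (S B) \<le> vimage_factor d t' * ennreal ((\<Prod>p\<in>B. a p) / fact d)" ..
  then have S: "\<And>B. B \<in> BB \<Longrightarrow> S B \<in> sets borel"
    "\<And>B m. B \<in> BB \<Longrightarrow> \<forall>p\<in>B. 0 \<le> m p \<Longrightarrow> sum m B \<le> 1 \<Longrightarrow> (\<Sum>p\<in>B. m p *\<^sub>R p) \<in> S B"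
    "\<And>B. B \<in> BB \<Longrightarrow> emeasure (leb d) (S B) \<le> vimage_factor d t' * ennreal ((\<Prod>p\<in>B. a p) / fact d)"
    by simp_all
  have "K \<subseteq> (\<Union>B\<in>BB. S B)"
  proof
    fix x assume "x \<in> K"
    then have "x \<in> convex hull P" using K by auto
    then obtain l where l: "\<forall>p\<in>P. 0 \<le> l p" "sum l P = 1" "(\<Sum>p\<in>P. l p *\<^sub>R p) = x"
      by (auto simp: convex_hull_finite[OF P(1)])
    then obtain I m where I: "I \<subseteq> P" "independent I" "\<forall>p\<in>I. 0 \<le> m p" "sum m I \<le> 1"
        "x = (\<Sum>p\<in>I. m p *\<^sub>R p)"
      using conic_caratheodory[of P l 1 x] P(1) by force
    \<comment> \<open>Extending \<open>I\<close> to a basis within \<open>P\<close>, with weight 0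
      on the new points, leaves only full-dimensional simplices to count.\<close>
    obtain B where B: "I \<subseteq> B" "B \<subseteq> P" "independent B" "P \<subseteq> span B"
      using maximal_independent_subset_extend[OF I(1,2)] by metis
    have finB: "finite B" using B P by (auto dest: finite_subset)
    have VB: "vec_space d \<subseteq> span B"
      using P(3) span_minimal[OF B(4) subspace_span] by blast
    have "d \<le> card B"
      by (rule card_spanning_ge[OF finB VB])
    moreover have "card B \<le> card (std_unit ` {..<d})"
      using independent_span_bound[of "std_unit ` {..<d}" B] B P by (auto simp: span_std_unit)
    ultimately have BB: "B \<in> BB"
      using B VB by (simp add: BB_def card_image inj_std_unit)
    define m' where "m' p = (if p \<in> I then m p else 0)" for p
    have "sum m' B = sum m I" "(\<Sum>p\<in>B. m' p *\<^sub>R p) = (\<Sum>p\<in>I. m p *\<^sub>R p)"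
      using B(1) finB by (auto intro!: sum.mono_neutral_cong_right simp: m'_def)
    then have "x \<in> S B"
      using S(2)[OF BB, of m'] I by (auto simp: m'_def)
    then show "x \<in> (\<Union>B\<in>BB. S B)" using BB by blast
  qed
  then have "emeasure (leb d) K \<le> emeasure (leb d) (\<Union>B\<in>BB. S B)"
    using S(1) finBB by (intro emeasure_mono) auto
  also have "\<dots> \<le> (\<Sum>B\<in>BB. emeasure (leb d) (S B))"
    using S(1) finBB by (intro emeasure_subadditive_finite) auto
  also have "\<dots> \<le> (\<Sum>B\<in>BB. vimage_factor d t' * ennreal ((\<Prod>p\<in>B. a p) / fact d))"
    using S(3) by (intro sum_mono) auto
  also have "\<dots> = vimage_factor d t' * (\<Sum>B\<in>BB. ennreal ((\<Prod>p\<in>B. a p) / fact d))"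
    by (simp add: sum_distrib_left)
  also have "(\<Sum>B\<in>BB. ennreal ((\<Prod>p\<in>B. a p) / fact d)) = ennreal (\<Sum>B\<in>BB. (\<Prod>p\<in>B. a p) / fact d)"
    using a0 by (intro sum_ennreal) (auto intro!: divide_nonneg_nonneg prod_nonneg)
  also have "\<dots> \<le> ennreal ((sum a P) ^ d / (fact d)\<^sup>2)"
  proof (rule ennreal_leI)
    have "(\<Sum>B\<in>BB. (\<Prod>p\<in>B. a p) / fact d) = (\<Sum>B\<in>BB. \<Prod>p\<in>B. a p) / fact d"
      by (simp add: sum_divide_distrib)
    also have "(\<Sum>B\<in>BB. \<Prod>p\<in>B. a p) \<le> (\<Sum>B | B \<subseteq> P \<and> card B = d. prod a B)"
      using a0 P(1) by (intro sum_mono2) (auto simp: BB_def intro!: prod_nonneg)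
    also have "\<dots> \<le> (sum a P) ^ d / fact d"
      using a0 P(1) by (intro elementary_symmetric_le) auto
    finally show "(\<Sum>B\<in>BB. (\<Prod>p\<in>B. a p) / fact d) \<le> (sum a P) ^ d / (fact d)\<^sup>2"
      by (simp add: divide_right_mono power2_eq_square)
  qed
  finally show ?thesis
    by (simp add: a_def mult_left_mono)
qed

section \<open>Volumes and ellipsoids in matrix form\<close>

text \<open>Restriction and extension by 0 are mutually inverse between \<open>vec_space d\<close>
  and the product space; this identifies \<open>vol\<close> with \<open>leb\<close>.\<close>

lemma vimage_extend_zero_eq:
  assumes "S \<subseteq> vec_space d"
  shows "(\<lambda>x. restrict x {..<d}) ` S = extend_zero d -` S \<inter> space (\<Pi>\<^sub>M i\<in>{..<d}. (lborel :: real measure))"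
proof (intro equalityI subsetI)
  fix y assume "y \<in> (\<lambda>x. restrict x {..<d}) ` S"
  then obtain x where x: "x \<in> S" "y = restrict x {..<d}" by auto
  have "extend_zero d y = x"
    using assms x by (auto simp: extend_zero_def fun_eq_iff vec_space_iff)
  then show "y \<in> extend_zero d -` S \<inter> space (\<Pi>\<^sub>M i\<in>{..<d}. lborel)"
    using x by (auto simp: space_PiM)
next
  fix y assume y: "y \<in> extend_zero d -` S \<inter> space (\<Pi>\<^sub>M i\<in>{..<d}. (lborel :: real measure))"
  then have "y = restrict (extend_zero d y) {..<d}"
    by (auto simp: extend_zero_def space_PiM PiE_def extensional_def restrict_def fun_eq_iff)
  then show "y \<in> (\<lambda>x. restrict x {..<d}) ` S"
    using y by blast
qed

lemma vol_eq_measure_leb: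
  assumes "S \<subseteq> vec_space d" "S \<in> sets borel"
  shows "vol d S = measure (leb d) S"
  unfolding vol_def vimage_extend_zero_eq[OF assms(1)] leb_def
  by (rule measure_distr[symmetric]) (use assms in auto)

text \<open>\<^const>\<open>vol\<close> is 0 on non-measurable sets.\<close>

lemma vol_zero_or_borel:
  assumes "S \<subseteq> vec_space d"
  shows "vol d S = 0 \<or> S \<in> sets borel"
proof (cases "(\<lambda>x. restrict x {..<d}) ` S \<in> sets (\<Pi>\<^sub>M i\<in>{..<d}. (lborel :: real measure))")
  case True
  have r [measurable]: "(\<lambda>x. restrict x {..<d}) \<in> borel \<rightarrow>\<^sub>M (\<Pi>\<^sub>M i\<in>{..<d}. (lborel :: real measure))"
    by (rule measurable_restrict) auto
  \<comment> \<open>Restriction is injective on \<open>vec_space d\<close>, so \<open>S\<close> is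
    recovered as a preimage.\<close>
  have "S = ((\<lambda>x. restrict x {..<d}) -` ((\<lambda>x. restrict x {..<d}) ` S) \<inter> space borel) \<inter> vec_space d"
  proof (intro equalityI subsetI)
    fix x assume x: "x \<in> ((\<lambda>x. restrict x {..<d}) -` ((\<lambda>x. restrict x {..<d}) ` S) \<inter> space borel) \<inter> vec_space d"
    then obtain y where y: "y \<in> S" "restrict x {..<d} = restrict y {..<d}" by auto
    then have "x i = y i" if "i < d" for i
      using that by (metis lessThan_iff restrict_apply')
    moreover have "x i = y i" if "\<not> i < d" for i
      using that x y(1) assms by (auto simp: vec_space_iff)
    ultimately have "x = y" by blast
    then show "x \<in> S" using y by simp
  qed (use assms in auto)
  also have "\<dots> \<in> sets borel"
    using measurable_sets[OF r True] by auto
  finally show ?thesis ..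
next
  case False
  then show ?thesis
    unfolding vol_def by (simp add: measure_notin_sets)
qed

text \<open>The columns of \<open>t\<close> are the images of the unit vectors. They span because
  \<open>T\<close> is onto \<open>vec_space d\<close>, so an inverse matrix exists.\<close>

lemma ellipsoidE:
  assumes "ellipsoid d E"
  obtains t t' c where "inverse_cols d t t'" "c \<in> vec_space d"
    "E = {x \<in> vec_space d. norm_sq d (col_comb d t' (x - c)) \<le> 1}"
proof -
  obtain T c where T: "linear T" "T ` vec_space d = vec_space d" "c \<in> vec_space d"
    "E = (\<lambda>x. c + T x) ` unit_ball d"
    using assms unfolding ellipsoid_def by blast
  define t where "t j = T (std_unit j)" for j
  have Tt: "T x = col_comb d t x" if "x \<in> vec_space d" for x
  proof -
    have "T x = T (\<Sum>j<d. x j *\<^sub>R std_unit j)"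
      using col_comb_unit[OF that] by (simp add: col_comb_eq_sum)
    also have "\<dots> = (\<Sum>j<d. x j *\<^sub>R T (std_unit j))"
      by (simp add: linear_sum[OF T(1)] linear_scale[OF T(1)])
    finally show ?thesis by (simp add: col_comb_eq_sum t_def)
  qed
  have tV: "t j \<in> vec_space d" if "j < d" for j
    using T(2) std_unit_in_vec_space[OF that] by (auto simp: t_def)
  have "vec_space d \<subseteq> span (t ` {..<d})"
  proof
    fix y assume "y \<in> vec_space d"
    then obtain x where "x \<in> vec_space d" "y = T x" using T(2) by blast
    then have "y = (\<Sum>j<d. x j *\<^sub>R t j)"
      by (simp add: Tt col_comb_eq_sum)
    moreover have "(\<Sum>j<d. x j *\<^sub>R t j) \<in> span (t ` {..<d})"
      by (intro span_sum span_scale span_base) auto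
    ultimately show "y \<in> span (t ` {..<d})" by simp
  qed
  then obtain t' where t': "inverse_cols d t t'"
    using inverse_cols_of_span[of d t, OF tV] by metis
  have V: "col_comb d t x \<in> vec_space d" "col_comb d t' x \<in> vec_space d" for x
    using t' by (auto simp: inverse_cols_def intro!: col_comb_in_vec_space)
  have ub: "unit_ball d = {x \<in> vec_space d. norm_sq d x \<le> 1}"
    by (simp add: unit_ball_def norm_sq_def)
  have "E = {x \<in> vec_space d. norm_sq d (col_comb d t' (x - c)) \<le> 1}"
  proof (intro equalityI subsetI)
    fix y assume "y \<in> E"
    then obtain x where x: "x \<in> vec_space d" "norm_sq d x \<le> 1" "y = c + T x"
      by (auto simp: T(4) ub)
    then show "y \<in> {x \<in> vec_space d. norm_sq d (col_comb d t' (x - c)) \<le> 1}"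
      using t' V T(3) subspace_add[OF subspace_vec_space]
      by (auto simp: Tt inverse_cols_def)
  next
    fix y assume y: "y \<in> {x \<in> vec_space d. norm_sq d (col_comb d t' (x - c)) \<le> 1}"
    then have "y - c \<in> vec_space d"
      using subspace_diff[OF subspace_vec_space] T(3) by auto
    then have "col_comb d t (col_comb d t' (y - c)) = y - c"
      using t' by (simp add: inverse_cols_def)
    then have "y = c + T (col_comb d t' (y - c))"
      using V by (simp add: Tt)
    then show "y \<in> E"
      using y V unfolding T(4) ub by blast
  qed
  then show thesis using that t' T(3) by blast
qed

lemma emeasure_ellipsoid:
  assumes t: "inverse_cols d t t'" and c: "c \<in> vec_space d"
  shows "emeasure (leb d) {x \<in> vec_space d. norm_sq d (col_comb d t' (x - c)) \<le> 1} =
    vimage_factor d t' * emeasure (leb d) {x. norm_sq d x \<le> 1}"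
proof -
  let ?f = "\<lambda>x. indicator {x. norm_sq d (col_comb d t' x) \<le> 1} x :: ennreal"
  have mc: "- c \<in> vec_space d" using c by (simp add: vec_space_iff)
  have "emeasure (leb d) {x \<in> vec_space d. norm_sq d (col_comb d t' (x - c)) \<le> 1} =
      emeasure (leb d) {x. norm_sq d (col_comb d t' (x - c)) \<le> 1}"
  proof (rule emeasure_eq_AE)
    show "AE x in leb d. x \<in> {x \<in> vec_space d. norm_sq d (col_comb d t' (x - c)) \<le> 1} \<longleftrightarrow>
        x \<in> {x. norm_sq d (col_comb d t' (x - c)) \<le> 1}"
      using AE_leb_vec_space by eventually_elim auto
  qed auto
  also have "\<dots> = (\<integral>\<^sup>+x. ?f (x + - c) \<partial>leb d)"
  proof -
    have "(\<integral>\<^sup>+x. ?f (x + - c) \<partial>leb d) = (\<integral>\<^sup>+x. indicator {x. norm_sq d (col_comb d t' (x - c)) \<le> 1} x \<partial>leb d)"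
      by (intro nn_integral_cong) (auto simp: indicator_def)
    also have "\<dots> = emeasure (leb d) {x. norm_sq d (col_comb d t' (x - c)) \<le> 1}"
      by (rule nn_integral_indicator) simp
    finally show ?thesis ..
  qed
  also have "\<dots> = (\<integral>\<^sup>+x. ?f x \<partial>leb d)"
    by (rule nn_integral_leb_translation[OF mc]) simp
  also have "\<dots> = emeasure (leb d) {x. col_comb d t' x \<in> {x. norm_sq d x \<le> 1}}"
    by (subst nn_integral_indicator) auto
  also have "\<dots> = vimage_factor d t' * emeasure (leb d) {x. norm_sq d x \<le> 1}"
    by (rule emeasure_col_comb_vimage[OF inverse_cols_sym[OF t]]) simp
  finally show ?thesis .
qed

text \<open>Both the volume of \<open>E\<close> and the bound for the hull carry the factor
  \<open>J = |det t|\<close>, so their comparison does not depend on the shape of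
  \<open>E\<close>.\<close>

lemma vol_hull_ellipsoid_le:
  assumes E: "ellipsoid d E" "K \<subseteq> E" and sym: "origin_symmetric K"
    and P: "finite P" "P \<subseteq> vec_space d" "vec_space d \<subseteq> span P" "K \<subseteq> convex hull P"
    and absorb: "\<And>p. p \<in> P \<Longrightarrow> \<exists>l>0. p \<in> (\<lambda>y. l *\<^sub>R y) ` K" and d: "d > 0"
  shows "vol d K * ((fact d)\<^sup>2 * (2 / sqrt d) ^ d) \<le> vol d E * (\<Sum>p\<in>P. body_norm K p) ^ d"
proof -
  obtain t t' c where t: "inverse_cols d t t'" and c: "c \<in> vec_space d"
    and E_eq: "E = {x \<in> vec_space d. norm_sq d (col_comb d t' (x - c)) \<le> 1}"
    using ellipsoidE[OF E(1)] by blast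
  have E_sets: "E \<in> sets borel"
    unfolding E_eq by measurable
  have EV: "E \<subseteq> vec_space d" by (auto simp: E_eq)
  \<comment> \<open>By symmetry of \<open>K\<close>, \<open>y\<close> is half the difference of
    \<open>y - c\<close> and \<open>- y - c\<close>; convexity of the square then removes the
    centre.\<close>
  have centred: "norm_sq d (col_comb d t' y) \<le> 1" if y: "y \<in> K" for y
  proof -
    let ?a = "col_comb d t' (y - c)" and ?b = "col_comb d t' (- y - c)"
    have "- y \<in> K" using sym y by (auto simp: origin_symmetric_def)
    then have ab: "norm_sq d ?a \<le> 1" "norm_sq d ?b \<le> 1"
      using E(2) y unfolding E_eq by blast+
    have "col_comb d t' y i = (?a i - ?b i) / 2" for i
      by (simp add: col_comb_diff col_comb_minus)
    moreover have "((u - v) / 2)\<^sup>2 \<le> (u\<^sup>2 + v\<^sup>2) / 2" for u v :: real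
      using zero_le_power2[of "u + v"] by (simp add: power2_eq_square field_simps)
    ultimately have "norm_sq d (col_comb d t' y) \<le> (\<Sum>i<d. ((?a i)\<^sup>2 + (?b i)\<^sup>2) / 2)"
      unfolding norm_sq_def[of d "col_comb d t' y"] by (intro sum_mono) presburger
    also have "\<dots> = (norm_sq d ?a + norm_sq d ?b) / 2"
      by (simp add: norm_sq_def sum.distrib sum_divide_distrib[symmetric])
    finally show ?thesis using ab by simp
  qed
  have norm_le: "sqrt (norm_sq d (col_comb d t' p)) \<le> body_norm K p" if p: "p \<in> P" for p
    unfolding body_norm_def
  proof (rule cInf_greatest)
    show "{l. 0 < l \<and> p \<in> (\<lambda>y. l *\<^sub>R y) ` K} \<noteq> {}"
      using absorb[OF p] by auto
    fix l assume "l \<in> {l. 0 < l \<and> p \<in> (\<lambda>y. l *\<^sub>R y) ` K}"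
    then obtain y where l: "l > 0" and y: "y \<in> K" "p = l *\<^sub>R y" by auto
    have "col_comb d t' p = l *\<^sub>R col_comb d t' y"
      by (simp only: y col_comb_scaleR)
    then have "norm_sq d (col_comb d t' p) = l\<^sup>2 * norm_sq d (col_comb d t' y)"
      by (simp add: norm_sq_def scaleR_fun_def power_mult_distrib sum_distrib_left)
    also have "\<dots> \<le> l\<^sup>2"
      using centred[OF y(1)] by (simp add: mult_left_le)
    finally show "sqrt (norm_sq d (col_comb d t' p)) \<le> l"
      using l by (simp add: real_le_lsqrt)
  qed
  let ?s = "\<Sum>p\<in>P. sqrt (norm_sq d (col_comb d t' p))"
  have s0: "0 \<le> ?s" by (auto intro!: sum_nonneg simp: norm_sq_def)
  have s_le: "?s \<le> (\<Sum>p\<in>P. body_norm K p)"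
    by (rule sum_mono[OF norm_le])
  have jtop: "vimage_factor d t' \<noteq> \<infinity>"
  proof
    assume "vimage_factor d t' = \<infinity>"
    then have "vimage_factor d t * \<infinity> = 1"
      using vimage_factor_inverse[OF t] by simp
    then show False by (auto simp: ennreal_mult_top split: if_splits)
  qed
  define J where "J = enn2real (vimage_factor d t')"
  have J: "vimage_factor d t' = ennreal J" "J \<ge> 0"
    using jtop by (auto simp: J_def less_top)
  define beta where "beta = measure (leb d) {x. norm_sq d x \<le> 1}"
  have beta: "emeasure (leb d) {x. norm_sq d x \<le> 1} = ennreal beta"
    unfolding beta_def using emeasure_ball_finite[of d] by (intro emeasure_eq_ennreal_measure) auto
  have beta_ge: "beta \<ge> (2 / sqrt d) ^ d"
    using emeasure_ball_lower[OF d] unfolding beta by (simp add: beta_def)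
  have volE: "vol d E = J * beta"
    using emeasure_ellipsoid[OF t c] unfolding vol_eq_measure_leb[OF EV E_sets] E_eq[symmetric] beta J
    by (simp add: measure_def enn2real_mult J(2) beta_def)
  have volK: "vol d K \<le> J * (?s ^ d / (fact d)\<^sup>2)"
  \<comment> \<open>The case of volume 0 also covers a \<open>K\<close> that is not Borel.\<close>
  proof (cases "vol d K = 0")
    case True
    then show ?thesis using J s0 by simp
  next
    case False
    have KV: "K \<subseteq> vec_space d" using E(2) EV by blast
    then have "K \<in> sets borel" using False vol_zero_or_borel by blast
    then have "vol d K = measure (leb d) K"
      using KV by (intro vol_eq_measure_leb)
    moreover have "emeasure (leb d) K \<le> ennreal (J * (?s ^ d / (fact d)\<^sup>2))"
    proof -
      have "emeasure (leb d) K \<le> ennreal J * ennreal (?s ^ d / (fact d)\<^sup>2)"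
        using emeasure_convex_hull_le[OF t P] unfolding J(1) .
      also have "\<dots> = ennreal (J * (?s ^ d / (fact d)\<^sup>2))"
        using J s0 by (intro ennreal_mult[symmetric]) auto
      finally show ?thesis .
    qed
    then have "measure (leb d) K \<le> J * (?s ^ d / (fact d)\<^sup>2)"
      unfolding measure_def using J s0 by (intro enn2real_leI) auto
    ultimately show ?thesis by simp
  qed
  have "vol d K * ((fact d)\<^sup>2 * (2 / sqrt d) ^ d) \<le> J * (?s ^ d / (fact d)\<^sup>2) * ((fact d)\<^sup>2 * beta)"
    using volK beta_ge J s0 by (intro mult_mono) auto
  also have "\<dots> = J * beta * ?s ^ d"
    by simp
  also have "\<dots> \<le> J * beta * (\<Sum>p\<in>P. body_norm K p) ^ d"
    using J s0 s_le beta_ge by (intro mult_left_mono power_mono) (auto simp: beta_def)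
  finally show ?thesis
    by (simp add: volE)
qed

text \<open>After inserting \<open>d! >= (d / e)^d\<close>, the \<open>d\<close>-th root of the
  claim reduces to \<open>1 / sqrt (2 pi e) <= 2 / e^2\<close>, that is
  \<open>e^3 <= 8 pi\<close>.\<close>

lemma lower_bound_constant:
  assumes "d > 0"
  shows "(real d powr (3/2) / sqrt (2 * pi * exp 1)) ^ d \<le> (fact d)\<^sup>2 * (2 / sqrt d) ^ d"
proof -
  have e: "exp (1::real) < 272 / 100" by (rule e_less_272)
  have "exp 1 ^ 3 \<le> (272 / 100 :: real) ^ 3"
    using e by (intro power_mono) auto
  also have "\<dots> \<le> 8 * pi" using pi_gt3 by (simp add: power3_eq_cube)
  finally have "exp 1 ^ 4 \<le> 4 * (2 * pi * exp (1::real))"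
    by (simp add: eval_nat_numeral mult_ac)
  then have "exp 1 ^ 2 \<le> sqrt (4 * (2 * pi * exp (1::real)))"
    by (intro real_le_rsqrt) (simp add: power_mult[symmetric])
  also have "\<dots> = 2 * sqrt (2 * pi * exp 1)"
    by (subst real_sqrt_mult) simp
  finally have c: "1 / sqrt (2 * pi * exp 1) \<le> 2 / (exp (1::real))\<^sup>2"
    by (simp add: field_simps)
  have fact: "real d ^ d / exp 1 ^ d \<le> fact d"
  proof -
    have "real d ^ d / fact d \<le> exp (real d)"
    proof -
      \<comment> \<open>The single term \<open>k = d\<close> of the exponential series at
        \<open>d\<close>.\<close>
      have "(\<Sum>k\<in>{d}. real d ^ k /\<^sub>R fact k) \<le> (\<Sum>k. real d ^ k /\<^sub>R fact k)"
        by (intro sum_le_suminf summable_exp_generic) auto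
      then show ?thesis by (simp add: exp_def field_simps)
    qed
    then show ?thesis
      by (simp add: field_simps exp_of_nat_mult[symmetric])
  qed
  have p: "real d powr (3/2) = real d ^ 2 / sqrt d"
  proof -
    have "real d powr (3/2) = real d powr (2 - 1/2)" by simp
    also have "\<dots> = real d powr 2 / real d powr (1/2)" by (rule powr_diff)
    finally show ?thesis using assms by (simp add: powr_half_sqrt)
  qed
  have "(real d powr (3/2) / sqrt (2 * pi * exp 1)) ^ d =
      (real d ^ 2 / sqrt d * (1 / sqrt (2 * pi * exp 1))) ^ d"
    by (simp add: p)
  also have "\<dots> \<le> (real d ^ 2 / sqrt d * (2 / (exp (1::real))\<^sup>2)) ^ d"
    using c by (intro power_mono mult_left_mono) auto
  also have "\<dots> = (real d ^ d / exp 1 ^ d)\<^sup>2 * (2 / sqrt d) ^ d"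
    by (simp add: power_divide power_mult_distrib power_mult[symmetric] mult.commute)
  also have "\<dots> \<le> (fact d)\<^sup>2 * (2 / sqrt d) ^ d"
    using fact by (intro mult_right_mono power_mono) auto
  finally show ?thesis .
qed

section \<open>Coordinate ascent on determinants\<close>

text \<open>Sylvester's determinant identity: the block matrix \<open>?W\<close> factors as
  \<open>?L * ?P\<close> and as \<open>?Q * ?L\<close> with block triangular factors and
  \<open>det ?L = 1\<close>.\<close>

lemma det_one_minus_mult:
  fixes U :: "real mat"
  assumes U: "U \<in> carrier_mat n m" and V: "V \<in> carrier_mat m n"
  shows "det (1\<^sub>m n - U * V) = det (1\<^sub>m m - V * U)"
proof -
  let ?W = "four_block_mat (1\<^sub>m n) U V (1\<^sub>m m)"
  let ?L = "four_block_mat (1\<^sub>m n) (0\<^sub>m n m) V (1\<^sub>m m)"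
  let ?P = "four_block_mat (1\<^sub>m n) U (0\<^sub>m m n) (1\<^sub>m m - V * U)"
  let ?Q = "four_block_mat (1\<^sub>m n - U * V) U (0\<^sub>m m n) (1\<^sub>m m)"
  have UV: "U * V \<in> carrier_mat n n" and VU: "V * U \<in> carrier_mat m m"
    using U V by auto
  have c1: "V * U + (1\<^sub>m m - V * U) = 1\<^sub>m m" and c2: "1\<^sub>m n - U * V + U * V = 1\<^sub>m n"
  proof -
    have "X + (1\<^sub>m k - X) = 1\<^sub>m k \<and> 1\<^sub>m k - X + X = 1\<^sub>m k" if "X \<in> carrier_mat k k" for X :: "real mat" and k
      using that by (auto intro!: eq_matI)
    then show "V * U + (1\<^sub>m m - V * U) = 1\<^sub>m m" "1\<^sub>m n - U * V + U * V = 1\<^sub>m n"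
      using UV VU by blast+
  qed
  have P: "?L * ?P = ?W"
    using U V VU c1 by (subst mult_four_block_mat[of _ n n _ m _ m _ _ n _ m]) auto
  have Q: "?Q * ?L = ?W"
    using U V UV c2 by (subst mult_four_block_mat[of _ n n _ m _ m _ _ n _ m]) auto
  have car: "?L \<in> carrier_mat (n + m) (n + m)" "?P \<in> carrier_mat (n + m) (n + m)"
      "?Q \<in> carrier_mat (n + m) (n + m)"
    using U V UV VU by auto
  have L: "det ?L = 1"
    using det_four_block_mat_upper_right_zero[OF one_carrier_mat refl V one_carrier_mat] by simp
  have "det ?P = det ?W"
    using det_mult[OF car(1,2)] L P by simp
  moreover have "det ?Q = det ?W"
    using det_mult[OF car(3,1)] L Q by simp
  moreover have "det ?P = det (1\<^sub>m m - V * U)"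
    using det_four_block_mat_lower_left_zero[OF one_carrier_mat U refl minus_carrier_mat[OF VU]] by simp
  moreover have "det ?Q = det (1\<^sub>m n - U * V)"
    using det_four_block_mat_lower_left_zero[OF minus_carrier_mat[OF UV] U refl one_carrier_mat] by simp
  ultimately show ?thesis by simp
qed

text \<open>Sylvester's identity with inner dimension 1; the sign is put into the column
  \<open>?U\<close>.\<close>

lemma det_one_plus_rank_one:
  fixes x y :: "nat \<Rightarrow> real"
  shows "det (mat d d (\<lambda>(i, j). (if i = j then 1 else 0) + y i * x j)) = 1 + (\<Sum>j<d. x j * y j)"
proof -
  let ?U = "mat d 1 (\<lambda>(i, _). - y i)" and ?V = "mat 1 d (\<lambda>(_, j). x j)"
  have "mat d d (\<lambda>(i, j). (if i = j then 1 else 0) + y i * x j) = 1\<^sub>m d - ?U * ?V"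
    by (rule eq_matI) (auto simp: scalar_prod_def)
  also have "det \<dots> = det (1\<^sub>m 1 - ?V * ?U)"
    by (rule det_one_minus_mult) auto
  also have "\<dots> = 1 + (\<Sum>j<d. x j * y j)"
    by (subst det_single) (auto simp: scalar_prod_def sum_negf atLeast0LessThan)
  finally show ?thesis .
qed

lemma solve_linear_system:
  fixes A :: "real mat"
  assumes A: "A \<in> carrier_mat d d" "det A \<noteq> 0"
  shows "\<exists>y. \<forall>j<d. (\<Sum>k<d. A $$ (j, k) * y k) = x j"
proof -
  let ?v = "vec d x"
  let ?y = "(1 / det A) \<cdot>\<^sub>v (adj_mat A *\<^sub>v ?v)"
  note adj = adj_mat[OF A(1)]
  have c: "adj_mat A *\<^sub>v ?v \<in> carrier_vec d" "?v \<in> carrier_vec d"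
    using adj(1) by auto
  have "A *\<^sub>v ?y = (1 / det A) \<cdot>\<^sub>v (A *\<^sub>v (adj_mat A *\<^sub>v ?v))"
    using A c by (intro mult_mat_vec) auto
  also have "A *\<^sub>v (adj_mat A *\<^sub>v ?v) = (det A \<cdot>\<^sub>m 1\<^sub>m d) *\<^sub>v ?v"
    using A adj c by (simp add: assoc_mult_mat_vec[symmetric])
  also have "\<dots> = det A \<cdot>\<^sub>v (1\<^sub>m d *\<^sub>v ?v)"
    using c by auto
  also have "\<dots> = det A \<cdot>\<^sub>v ?v"
    by simp
  finally have eq: "A *\<^sub>v ?y = ?v"
    using A(2) by (simp add: smult_smult_assoc)
  define z where "z = ?y"
  have z: "z \<in> carrier_vec d" "A *\<^sub>v z = ?v"
    using c eq by (auto simp: z_def)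
  have "(\<Sum>k<d. A $$ (j, k) * (z $ k)) = x j" if "j < d" for j
  proof -
    have "x j = (A *\<^sub>v z) $ j"
      using that by (simp add: z(2))
    also have "\<dots> = (\<Sum>k<d. A $$ (j, k) * (z $ k))"
      using that A(1) z(1) by (simp add: scalar_prod_def atLeast0LessThan)
    finally show ?thesis ..
  qed
  then show ?thesis by (intro exI[of _ "\<lambda>k. z $ k"]) auto
qed

text \<open>Leibniz expansion. The bound is crude, but only its logarithm enters the number of
  ascent steps.\<close>

lemma abs_det_le:
  fixes A :: "real mat"
  assumes A: "A \<in> carrier_mat d d" and b: "\<And>i j. i < d \<Longrightarrow> j < d \<Longrightarrow> \<bar>A $$ (i, j)\<bar> \<le> M"
  shows "\<bar>det A\<bar> \<le> fact d * M ^ d"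
proof -
  have "\<bar>det A\<bar> = \<bar>\<Sum>p\<in>{p. p permutes {0..<d}}. signof p * (\<Prod>i = 0..<d. A $$ (i, p i))\<bar>"
    by (simp add: det_def'[OF A])
  also have "\<dots> \<le> (\<Sum>p\<in>{p. p permutes {0..<d}}. \<bar>signof p * (\<Prod>i = 0..<d. A $$ (i, p i))\<bar>)"
    by (rule sum_abs)
  also have "\<dots> \<le> (\<Sum>p\<in>{p. p permutes {0..<d}}. M ^ d)"
  proof (rule sum_mono)
    fix p assume p: "p \<in> {p. p permutes {0..<d}}"
    have "\<bar>signof p * (\<Prod>i = 0..<d. A $$ (i, p i))\<bar> = (\<Prod>i = 0..<d. \<bar>A $$ (i, p i)\<bar>)"
      by (simp add: abs_mult abs_prod sign_def)
    also have "\<dots> \<le> (\<Prod>i = 0..<d. M)"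
      using p by (intro prod_mono) (auto intro!: b simp: permutes_in_image)
    finally show "\<bar>signof p * (\<Prod>i = 0..<d. A $$ (i, p i))\<bar> \<le> M ^ d"
      by simp
  qed
  also have "\<dots> = fact d * M ^ d"
    by (simp add: card_permutations)
  finally show ?thesis .
qed

section \<open>Moment matrices and the ascent step\<close>

definition moment_mat :: "nat \<Rightarrow> nat \<Rightarrow> (nat \<Rightarrow> real) \<Rightarrow> (nat \<Rightarrow> nat \<Rightarrow> real) \<Rightarrow> real mat"
  where "moment_mat d n w f = mat d d (\<lambda>(j, k). \<Sum>i<n. w i * f i j * f i k)"

text \<open>In the first \<open>d\<close> coordinates, \<open>S\<close> lies in
  \<open>2 * sqrt d\<close> times the absolutely convex hull of its points
  \<open>f i\<close>.\<close>

definition spans_with :: "nat \<Rightarrow> (nat \<Rightarrow> real) set \<Rightarrow> nat \<Rightarrow> (nat \<Rightarrow> nat \<Rightarrow> real) \<Rightarrow> bool"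
  where "spans_with d S n f \<longleftrightarrow> (\<forall>i<n. f i \<in> S) \<and>
    (\<forall>x\<in>S. \<exists>a. (\<forall>j<d. x j = (\<Sum>i<n. a i * f i j)) \<and> (\<Sum>i<n. \<bar>a i\<bar>) \<le> 2 * sqrt d)"

text \<open>Cauchy-Schwarz, obtained from the nonnegative variance of \<open>|s i|\<close> under the
  weights \<open>w\<close>.\<close>

lemma weighted_l1_le:
  fixes w s :: "nat \<Rightarrow> real"
  assumes "\<And>i. i < n \<Longrightarrow> w i \<ge> 0" "(\<Sum>i<n. w i) = 1"
  shows "(\<Sum>i<n. \<bar>w i * s i\<bar>)\<^sup>2 \<le> (\<Sum>i<n. w i * (s i)\<^sup>2)"
proof -
  define m where "m = (\<Sum>i<n. w i * \<bar>s i\<bar>)"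
  have "0 \<le> (\<Sum>i<n. w i * (\<bar>s i\<bar> - m)\<^sup>2)"
    using assms(1) by (intro sum_nonneg) auto
  also have "\<dots> = (\<Sum>i<n. w i * (s i)\<^sup>2 - 2 * m * (w i * \<bar>s i\<bar>) + m\<^sup>2 * w i)"
    by (intro sum.cong) (auto simp: power2_diff algebra_simps)
  also have "\<dots> = (\<Sum>i<n. w i * (s i)\<^sup>2) - 2 * m * m + m\<^sup>2"
    using assms(2) by (simp add: sum.distrib sum_subtractf sum_distrib_left[symmetric] m_def[symmetric])
  finally have "m\<^sup>2 \<le> (\<Sum>i<n. w i * (s i)\<^sup>2)"
    by (simp add: power2_eq_square)
  moreover have "(\<Sum>i<n. \<bar>w i * s i\<bar>) = m"
    unfolding m_def using assms(1) by (intro sum.cong) (auto simp: abs_mult)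
  ultimately show ?thesis by simp
qed

text \<open>For an invertible moment matrix \<open>A\<close>, \<open>y\<close> is
  \<open>A^-1 x\<close>. Expanding \<open>A y\<close> gives coefficients for \<open>x\<close>, and
  \<open>x^T A^-1 x\<close> becomes the weighted second moment that \<open>weighted_l1_le\<close>
  bounds against.\<close>

lemma quadratic_form_moment_mat:
  assumes y: "\<And>j. j < d \<Longrightarrow> (\<Sum>k<d. moment_mat d n w f $$ (j, k) * y k) = x j"
  defines "s \<equiv> \<lambda>i. \<Sum>k<d. f i k * y k"
  shows "j < d \<Longrightarrow> x j = (\<Sum>i<n. (w i * s i) * f i j)"
    and "(\<Sum>j<d. x j * y j) = (\<Sum>i<n. w i * (s i)\<^sup>2)"
proof -
  have x: "x j = (\<Sum>i<n. (w i * s i) * f i j)" if "j < d" for j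
  proof -
    have "x j = (\<Sum>k<d. \<Sum>i<n. w i * f i j * (f i k * y k))"
      using y[OF that] that by (simp add: moment_mat_def sum_distrib_right mult.assoc)
    also have "\<dots> = (\<Sum>i<n. \<Sum>k<d. w i * f i j * (f i k * y k))"
      by (rule sum.swap)
    also have "\<dots> = (\<Sum>i<n. (w i * s i) * f i j)"
      by (simp add: s_def sum_distrib_left sum_distrib_right mult_ac)
    finally show ?thesis .
  qed
  then show "j < d \<Longrightarrow> x j = (\<Sum>i<n. (w i * s i) * f i j)" .
  have "(\<Sum>j<d. x j * y j) = (\<Sum>j<d. \<Sum>i<n. (w i * s i) * (f i j * y j))"
    using x by (simp add: sum_distrib_right mult.assoc)
  also have "\<dots> = (\<Sum>i<n. \<Sum>j<d. (w i * s i) * (f i j * y j))"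
    by (rule sum.swap)
  also have "\<dots> = (\<Sum>i<n. w i * (s i)\<^sup>2)"
    by (simp add: s_def sum_distrib_left[symmetric] power2_eq_square mult.assoc)
  finally show "(\<Sum>j<d. x j * y j) = (\<Sum>i<n. w i * (s i)\<^sup>2)" .
qed

text \<open>The left side is the growth of the determinant when weight \<open>h\<close> moves to a
  point with \<open>x^T A^-1 x = k\<close>. One factor \<open>1 - h\<close> clears the denominator,
  Bernoulli bounds the other \<open>d - 1\<close> by \<open>1 / 2 + h\<close>, and
  \<open>h * k >= 2\<close>.\<close>

lemma ascent_factor:
  assumes d: "d \<ge> (1::nat)" and k: "k > 4 * real d"
  defines "h \<equiv> 1 / (2 * real d)"
  shows "(1 - h) ^ d * (1 + h / (1 - h) * k) \<ge> 3 / 2"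
proof -
  have h: "0 < h" "h \<le> 1 / 2" using d by (auto simp: h_def field_simps)
  have hd: "h * real d = 1 / 2" using d by (simp add: h_def)
  have "1 + real (d - 1) * (- h) \<le> (1 + (- h)) ^ (d - 1)"
    using h by (intro Bernoulli_inequality) auto
  then have 1: "1 / 2 + h \<le> (1 - h) ^ (d - 1)"
    using d hd by (simp add: of_nat_diff algebra_simps)
  have "h * k \<ge> h * (4 * real d)"
    using k h by (intro mult_left_mono) auto
  then have 2: "3 - h \<le> 1 - h + h * k"
    using hd by (simp add: algebra_simps)
  have "3 / 2 \<le> (1 / 2 + h) * (3 - h)"
  proof -
    have "h * h \<le> h * (1/2)" using h by (intro mult_left_mono) auto
    moreover have "(1 / 2 + h) * (3 - h) = 3 / 2 + 5 / 2 * h - h * h"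
      by (simp add: field_simps)
    ultimately show ?thesis using h by linarith
  qed
  also have "\<dots> \<le> (1 - h) ^ (d - 1) * (1 - h + h * k)"
    using 1 2 h by (intro mult_mono) auto
  also have "\<dots> = (1 - h) ^ d * (1 + h / (1 - h) * k)"
  proof -
    have "(1 - h) ^ d = (1 - h) ^ (d - 1) * (1 - h)"
      using d by (metis One_nat_def Suc_le_D diff_Suc_1 power_Suc2)
    moreover have "(1 - h) * (1 + h / (1 - h) * k) = 1 - h + h * k"
      using h by (simp add: field_simps)
    ultimately show ?thesis by (simp add: mult.assoc)
  qed
  finally show ?thesis .
qed

text \<open>The new moment matrix is
  \<open>(1 - h) A + h x x^T = (1 - h) A (1 + h / (1 - h) y x^T)\<close> with
  \<open>A y = x\<close>, so its determinant follows from the rank one formula.\<close>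

lemma moment_mat_step:
  assumes d: "d \<ge> 1" and S: "\<And>i. i < n \<Longrightarrow> f i \<in> S"
    and w: "\<And>i. i < n \<Longrightarrow> w i \<ge> 0" "(\<Sum>i<n. w i) = 1"
    and pos: "det (moment_mat d n w f) > 0" and not: "\<not> spans_with d S n f"
  shows "\<exists>f' w'. (\<forall>i<Suc n. f' i \<in> S \<and> w' i \<ge> 0) \<and> (\<Sum>i<Suc n. w' i) = 1 \<and>
    det (moment_mat d (Suc n) w' f') \<ge> 3 / 2 * det (moment_mat d n w f)"
proof -
  let ?A = "moment_mat d n w f"
  have A: "?A \<in> carrier_mat d d" by (simp add: moment_mat_def)
  have "\<exists>x\<in>S. \<not> (\<exists>a. (\<forall>j<d. x j = (\<Sum>i<n. a i * f i j)) \<and> (\<Sum>i<n. \<bar>a i\<bar>) \<le> 2 * sqrt d)"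
    using not S unfolding spans_with_def by blast
  then obtain x where x: "x \<in> S"
    "\<not> (\<exists>a. (\<forall>j<d. x j = (\<Sum>i<n. a i * f i j)) \<and> (\<Sum>i<n. \<bar>a i\<bar>) \<le> 2 * sqrt d)" ..
  obtain y where y: "\<forall>j<d. (\<Sum>k<d. ?A $$ (j, k) * y k) = x j"
    using solve_linear_system[OF A, of x] pos by auto
  define s where "s i = (\<Sum>k<d. f i k * y k)" for i
  define k where "k = (\<Sum>j<d. x j * y j)"
  have xs: "x j = (\<Sum>i<n. (w i * s i) * f i j)" if "j < d" for j
    using quadratic_form_moment_mat(1)[of d n w f y x j] y that by (simp add: s_def)
  have ks: "k = (\<Sum>i<n. w i * (s i)\<^sup>2)"
    using quadratic_form_moment_mat(2)[of d n w f y x] y by (simp add: s_def k_def)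
  \<comment> \<open>Otherwise the coefficients \<open>w i * s i\<close> would represent
    \<open>x\<close> within the allowed absolute sum, against the choice of
    \<open>x\<close>.\<close>
  have k: "k > 4 * real d"
  proof (rule ccontr)
    assume "\<not> k > 4 * real d"
    then have "(\<Sum>i<n. \<bar>w i * s i\<bar>)\<^sup>2 \<le> 4 * real d"
      using weighted_l1_le[of n w s] w by (simp add: ks)
    then have "(\<Sum>i<n. \<bar>w i * s i\<bar>) \<le> sqrt (4 * real d)"
      by (rule real_le_rsqrt)
    then have "(\<Sum>i<n. \<bar>w i * s i\<bar>) \<le> 2 * sqrt d"
      by (simp add: real_sqrt_mult)
    then have "(\<forall>j<d. x j = (\<Sum>i<n. (w i * s i) * f i j)) \<and> (\<Sum>i<n. \<bar>w i * s i\<bar>) \<le> 2 * sqrt d"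
      using xs by simp
    then have "\<exists>a. (\<forall>j<d. x j = (\<Sum>i<n. a i * f i j)) \<and> (\<Sum>i<n. \<bar>a i\<bar>) \<le> 2 * sqrt d"
      by (intro exI[of _ "\<lambda>i. w i * s i"])
    with x(2) show False by (rule notE)
  qed
  define h where "h = 1 / (2 * real d)"
  have h: "0 < h" "h \<le> 1 / 2" using d by (auto simp: h_def field_simps)
  define f' where "f' i = (if i < n then f i else x)" for i
  define w' where "w' i = (if i < n then (1 - h) * w i else h)" for i
  have nn: "(\<forall>i<Suc n. f' i \<in> S \<and> w' i \<ge> 0)"
    using S w(1) x(1) h by (auto simp: f'_def w'_def)
  have "(\<Sum>i<Suc n. w' i) = (1 - h) * (\<Sum>i<n. w i) + h"
    by (simp add: w'_def sum_distrib_left)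
  then have sum1: "(\<Sum>i<Suc n. w' i) = 1"
    using w(2) by simp
  define R where "R = mat d d (\<lambda>(i, j). (if i = j then 1 else 0) + h / (1 - h) * y i * x j)"
  have R: "R \<in> carrier_mat d d" by (simp add: R_def)
  have "moment_mat d (Suc n) w' f' = (1 - h) \<cdot>\<^sub>m (?A * R)"
  proof (rule eq_matI)
    fix i j assume ij: "i < dim_row ((1 - h) \<cdot>\<^sub>m (?A * R))" "j < dim_col ((1 - h) \<cdot>\<^sub>m (?A * R))"
    then have ij: "i < d" "j < d" using A R by auto
    have "((1 - h) \<cdot>\<^sub>m (?A * R)) $$ (i, j) = (1 - h) * (\<Sum>l<d. ?A $$ (i, l) * R $$ (l, j))"
      using ij A R by (simp add: scalar_prod_def atLeast0LessThan)
    also have "(\<Sum>l<d. ?A $$ (i, l) * R $$ (l, j)) =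
        (\<Sum>l<d. (if l = j then ?A $$ (i, l) else 0) + h / (1 - h) * x j * (?A $$ (i, l) * y l))"
      using ij by (intro sum.cong) (auto simp: R_def algebra_simps)
    also have "\<dots> = ?A $$ (i, j) + h / (1 - h) * x j * x i"
      using ij y by (simp add: sum.distrib sum_distrib_left[symmetric] del: times_divide_eq_left)
    also have "(1 - h) * \<dots> = (1 - h) * ?A $$ (i, j) + h * x i * x j"
      using h by (simp add: field_simps)
    also have "\<dots> = moment_mat d (Suc n) w' f' $$ (i, j)"
      using ij by (simp add: moment_mat_def f'_def w'_def sum_distrib_left mult.assoc)
    finally show "moment_mat d (Suc n) w' f' $$ (i, j) = ((1 - h) \<cdot>\<^sub>m (?A * R)) $$ (i, j)" ..
  qed (auto simp: moment_mat_def R_def)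
  then have "det (moment_mat d (Suc n) w' f') = (1 - h) ^ d * (det ?A * det R)"
    using A R by (simp add: det_mult[OF A R])
  also have "det R = 1 + (\<Sum>j<d. x j * (h / (1 - h) * y j))"
    unfolding R_def by (rule det_one_plus_rank_one)
  also have "(\<Sum>j<d. x j * (h / (1 - h) * y j)) = h / (1 - h) * k"
    unfolding k_def sum_distrib_left by (intro sum.cong) auto
  also have "(1 - h) ^ d * (det ?A * (1 + h / (1 - h) * k)) = ((1 - h) ^ d * (1 + h / (1 - h) * k)) * det ?A"
    by (simp add: mult_ac)
  also have "\<dots> \<ge> 3 / 2 * det ?A"
    using ascent_factor[OF d k] pos unfolding h_def by (intro mult_right_mono) auto
  finally show ?thesis
    using nn sum1 by blast
qed

lemma abs_det_moment_mat_le: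
  assumes f: "\<And>i j. i < n \<Longrightarrow> j < d \<Longrightarrow> \<bar>f i j\<bar> \<le> 2"
    and w: "\<And>i. i < n \<Longrightarrow> w i \<ge> 0" "(\<Sum>i<n. w i) = 1"
  shows "\<bar>det (moment_mat d n w f)\<bar> \<le> fact d * 4 ^ d"
proof (rule abs_det_le)
  fix j k assume jk: "j < d" "k < d"
  have "\<bar>moment_mat d n w f $$ (j, k)\<bar> \<le> (\<Sum>i<n. \<bar>w i * f i j * f i k\<bar>)"
    using jk by (simp add: moment_mat_def)
  also have "\<dots> \<le> (\<Sum>i<n. w i * 4)"
  proof (rule sum_mono)
    fix i assume "i \<in> {..<n}"
    then have i: "i < n" by simp
    have "\<bar>f i j\<bar> * \<bar>f i k\<bar> \<le> 2 * 2"
      using f[OF i] jk by (intro mult_mono) auto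
    then show "\<bar>w i * f i j * f i k\<bar> \<le> w i * 4"
      using w(1)[OF i] by (simp add: abs_mult mult.assoc mult_left_mono)
  qed
  also have "\<dots> = 4"
    using w(2) by (simp add: sum_distrib_right[symmetric])
  finally show "\<bar>moment_mat d n w f $$ (j, k)\<bar> \<le> 4" .
qed (simp add: moment_mat_def)

text \<open>
  Khachiyan's barycentric coordinate ascent: as long as some \<open>x \<in> S\<close> has \<open>x\<^sup>T A\<^sup>-\<^sup>1 x > 4 d\<close> for the
  moment matrix \<open>A\<close>, moving weight \<open>1 / (2 d)\<close> to \<open>x\<close> multiplies the determinant by at least \<open>3 / 2\<close>.
\<close>

lemma exists_spans_with:
  assumes d: "d \<ge> 2" and S: "\<And>x j. x \<in> S \<Longrightarrow> j < d \<Longrightarrow> \<bar>x j\<bar> \<le> 2"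
    and std_unit: "\<And>j. j < d \<Longrightarrow> std_unit j \<in> S"
  shows "\<exists>n f. real n \<le> 8 * real d * ln (2 * real d) \<and> spans_with d S n f"
proof -
  have ascent: "(\<exists>n f. n \<le> d + k \<and> spans_with d S n f) \<or>
    (\<exists>f w. (\<forall>i<d + k. f i \<in> S \<and> w i \<ge> 0) \<and> (\<Sum>i<d + k. w i) = 1 \<and>
       det (moment_mat d (d + k) w f) \<ge> (3 / 2) ^ k / real d ^ d)" for k
  proof (induction k)
    case 0
    \<comment> \<open>The ascent starts from uniform weights on the unit vectors.\<close>
    have "moment_mat d d (\<lambda>_. 1 / real d) std_unit = (1 / real d) \<cdot>\<^sub>m 1\<^sub>m d"
      by (rule eq_matI) (auto simp: moment_mat_def std_unit_def if_distrib[of "\<lambda>y. _ * y"] cong: if_cong)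
    then have "det (moment_mat d d (\<lambda>_. 1 / real d) std_unit) = 1 / real d ^ d"
      by (simp add: power_divide)
    then show ?case
      using std_unit d by (intro disjI2 exI[of _ std_unit] exI[of _ "\<lambda>_. 1 / real d"]) auto
  next
    case (Suc k)
    then consider n f where "n \<le> d + k" "spans_with d S n f"
      | f w where "\<forall>i<d + k. f i \<in> S \<and> w i \<ge> 0" "(\<Sum>i<d + k. w i) = 1"
          "det (moment_mat d (d + k) w f) \<ge> (3 / 2) ^ k / real d ^ d"
      by blast
    then show ?case
    proof cases
      case 1
      then have "n \<le> d + Suc k" by simp
      then show ?thesis using 1(2) by blast
    next
      case 2
      show ?thesis
      proof (cases "spans_with d S (d + k) f")
        case True
        then show ?thesis by (intro disjI1 exI[of _ "d + k"] exI[of _ f]) auto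
      next
        case False
        have "0 < (3 / 2) ^ k / real d ^ d" using d by simp
        then have "0 < det (moment_mat d (d + k) w f)" using 2(3) by linarith
        then obtain f' w' where *: "\<forall>i<Suc (d + k). f' i \<in> S \<and> w' i \<ge> 0" "(\<Sum>i<Suc (d + k). w' i) = 1"
          "det (moment_mat d (Suc (d + k)) w' f') \<ge> 3 / 2 * det (moment_mat d (d + k) w f)"
          using moment_mat_step[of d "d + k" f S w] 2 False d by auto
        have "(3 / 2) ^ Suc k / real d ^ d = 3 / 2 * ((3 / 2) ^ k / real d ^ d)" by simp
        also have "\<dots> \<le> det (moment_mat d (Suc (d + k)) w' f')"
          using *(3) 2(3) by linarith
        finally show ?thesis
          using *(1,2) by (intro disjI2 exI[of _ f'] exI[of _ w']) auto
      qed
    qed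
  qed
  \<comment> \<open>Since \<open>ln (3 / 2) >= 1 / 3\<close>, more than \<open>6 d ln (2 d)\<close>
    steps force \<open>(3 / 2) ^ k > (4 d^2)^d\<close>. This exceeds \<open>d^d\<close> times the
    upper bound \<open>fact d * 4 ^ d\<close> for the determinant.\<close>
  define k where "k = nat \<lfloor>6 * real d * ln (2 * real d)\<rfloor> + 1"
  have ln1: "ln (2 * real d) \<ge> 1"
  proof -
    have "exp 1 \<le> 2 * real d" using e_less_272 d by simp
    then show ?thesis using d by (simp add: ln_ge_iff)
  qed
  have k_gt: "real k > 6 * real d * ln (2 * real d)"
    unfolding k_def using ln1 by (simp add: of_nat_nat) linarith
  have k_le: "real k \<le> 6 * real d * ln (2 * real d) + 1"
    unfolding k_def using ln1 by (simp add: of_nat_nat)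
  have big: "fact d * 4 ^ d < (3 / 2) ^ k / real d ^ d"
  proof -
    have "ln (3 / 2 :: real) \<ge> 1 / 3"
      \<comment> \<open>From \<open>ln (2 / 3) <= 2 / 3 - 1\<close>.\<close>
      using ln_ge_iff ln_le_minus_one[of "2 / 3 :: real"] ln_div[of 2 "3::real"] ln_div[of 3 "2::real"] by simp
    then have "2 * real d * ln (2 * real d) < real k * ln (3 / 2)"
      using k_gt mult_left_mono[of "1/3" "ln (3/2)" "real k"] by simp
    also have "2 * real d * ln (2 * real d) = real d * ln (4 * real d ^ 2)"
      using d ln_realpow[of "2 * real d" 2] by (simp add: power_mult_distrib)
    also have "\<dots> = ln ((4 * real d ^ 2) ^ d)"
      by (rule ln_realpow[symmetric])
    also have "real k * ln (3 / 2) = ln ((3 / 2) ^ k)"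
      by (rule ln_realpow[symmetric])
    finally have "ln ((4 * real d ^ 2) ^ d) < ln ((3 / 2) ^ k)" .
    then have lt: "(4 * real d ^ 2) ^ d < (3 / 2) ^ k"
      using d by simp
    have "fact d * 4 ^ d * real d ^ d \<le> real d ^ d * 4 ^ d * real d ^ d"
      using fact_le_power[of d, where ?'a = real] by (intro mult_right_mono) auto
    also have "\<dots> = (4 * real d ^ 2) ^ d"
      by (simp add: power_mult_distrib power2_eq_square mult_ac)
    also note lt
    finally have "fact d * 4 ^ d * real d ^ d < (3 / 2) ^ k" .
    moreover have "0 < real d ^ d" using d by simp
    ultimately show ?thesis
      by (simp only: pos_less_divide_eq)
  qed
  have "\<not> (\<exists>f w. (\<forall>i<d + k. f i \<in> S \<and> w i \<ge> 0) \<and> (\<Sum>i<d + k. w i) = 1 \<and>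
       det (moment_mat d (d + k) w f) \<ge> (3 / 2) ^ k / real d ^ d)"
  proof
    assume "\<exists>f w. (\<forall>i<d + k. f i \<in> S \<and> w i \<ge> 0) \<and> (\<Sum>i<d + k. w i) = 1 \<and>
       det (moment_mat d (d + k) w f) \<ge> (3 / 2) ^ k / real d ^ d"
    then obtain f w where fw: "\<forall>i<d + k. f i \<in> S \<and> w i \<ge> 0" "(\<Sum>i<d + k. w i) = 1"
       "det (moment_mat d (d + k) w f) \<ge> (3 / 2) ^ k / real d ^ d" by blast
    have "\<bar>det (moment_mat d (d + k) w f)\<bar> \<le> fact d * 4 ^ d"
      using fw S by (intro abs_det_moment_mat_le) auto
    then show False using big fw(3) by linarith
  qed
  then obtain n f where nf: "n \<le> d + k" "spans_with d S n f"
    using ascent[of k] by blast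
  have "real n \<le> real d + real k" using nf(1) by linarith
  \<comment> \<open>The second \<open>d\<close> absorbs the \<open>+ 1\<close> in \<open>k\<close>;
    then \<open>ln (2 d) >= 1\<close> merges both terms.\<close>
  also have "\<dots> \<le> 2 * real d + 6 * real d * ln (2 * real d)"
    using k_le d by simp
  also have "\<dots> \<le> 2 * real d * ln (2 * real d) + 6 * real d * ln (2 * real d)"
    using ln1 d by simp
  finally show ?thesis
    using nf(2) by (intro exI[of _ n] exI[of _ f]) simp
qed

text \<open>The \<open>b j\<close> nearly maximise \<open>|det|\<close> over \<open>K\<close>. By
  Cramer's rule each coefficient is a quotient of two such determinants, and coming within a factor
  2 of the supremum bounds it by 2 without a maximiser. The axis points make the supremum
  positive.\<close>

lemma auerbach_basis:
  assumes K: "\<And>x i. x \<in> K \<Longrightarrow> \<bar>x i\<bar> \<le> R" and r: "r > 0" "\<And>j. j < d \<Longrightarrow> r *\<^sub>R std_unit j \<in> K"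
  shows "\<exists>b. (\<forall>j<d. b j \<in> K) \<and>
    (\<forall>x\<in>K. \<exists>c. (\<forall>i<d. x i = (\<Sum>j<d. c j * b j i)) \<and> (\<forall>j<d. \<bar>c j\<bar> \<le> 2))"
proof -
  define M where "M b = mat d d (\<lambda>(i, j). b j i)" for b :: "nat \<Rightarrow> nat \<Rightarrow> real"
  have M: "M b \<in> carrier_mat d d" for b by (simp add: M_def)
  define D where "D = {\<bar>det (M b)\<bar> | b. \<forall>j<d. b j \<in> K}"
  have bdd: "bdd_above D"
  proof (rule bdd_aboveI)
    fix t assume "t \<in> D"
    then obtain b where b: "\<forall>j<d. b j \<in> K" "t = \<bar>det (M b)\<bar>" by (auto simp: D_def)
    show "t \<le> fact d * R ^ d"
      unfolding b(2) using b(1) K by (intro abs_det_le[OF M]) (auto simp: M_def)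
  qed
  have "M (\<lambda>j. r *\<^sub>R std_unit j) = r \<cdot>\<^sub>m 1\<^sub>m d"
    by (rule eq_matI) (auto simp: M_def std_unit_def scaleR_fun_def)
  then have "\<bar>det (M (\<lambda>j. r *\<^sub>R std_unit j))\<bar> = r ^ d"
    using r(1) by simp
  then have rD: "r ^ d \<in> D"
    unfolding D_def using r(2) by (intro CollectI exI[of _ "\<lambda>j. r *\<^sub>R std_unit j"]) auto
  have Sup_pos: "Sup D > 0"
    using cSup_upper[OF rD bdd] r(1) zero_less_power[of r d] by linarith
  then have "Sup D / 2 < Sup D" by simp
  then obtain t where "t \<in> D" "Sup D / 2 < t"
    using less_cSupD[of D] rD by blast
  then obtain b where b: "\<forall>j<d. b j \<in> K" "Sup D / 2 < \<bar>det (M b)\<bar>"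
    by (auto simp: D_def)
  have "\<exists>c. (\<forall>i<d. x i = (\<Sum>j<d. c j * b j i)) \<and> (\<forall>j<d. \<bar>c j\<bar> \<le> 2)" if x: "x \<in> K" for x
  proof -
    have "det (M b) \<noteq> 0" using b(2) Sup_pos by auto
    then obtain c where c: "\<forall>j<d. (\<Sum>k<d. M b $$ (j, k) * c k) = x j"
      using solve_linear_system[OF M] by blast
    have rep: "x i = (\<Sum>j<d. c j * b j i)" if "i < d" for i
      using c that by (auto simp: M_def mult.commute)
    have "\<bar>c k\<bar> \<le> 2" if k: "k < d" for k
    proof -
      have "replace_col (M b) (M b *\<^sub>v vec d c) k = M (b(k := x))"
        using k c by (intro eq_matI) (auto simp: M_def replace_col_def scalar_prod_def atLeast0LessThan)
      then have "det (M (b(k := x))) = c k * det (M b)"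
        using cramer_lemma_mat[OF M, of "vec d c" k b] k by simp
      moreover have "\<bar>det (M (b(k := x)))\<bar> \<in> D"
        unfolding D_def using b(1) x by (intro CollectI exI[of _ "b(k := x)"]) auto
      ultimately have "\<bar>c k\<bar> * \<bar>det (M b)\<bar> \<le> Sup D"
        using cSup_upper[OF _ bdd] by (metis abs_mult)
      also have "\<dots> \<le> 2 * \<bar>det (M b)\<bar>" using b(2) by simp
      finally show ?thesis
        using b(2) Sup_pos by (simp add: mult_le_cancel_right)
    qed
    then show ?thesis using rep by blast
  qed
  then show ?thesis using b(1) by blast
qed

section \<open>Symmetric convex bodies\<close>

text \<open>Compactness in the product topology bounds each coordinate separately; a common bound
  exists because all but \<open>d\<close> coordinates vanish.\<close>

lemma convex_body_bounded:
  assumes "convex_body d K"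
  shows "K \<subseteq> vec_space d" and "\<exists>R. \<forall>x\<in>K. \<forall>i. \<bar>x i\<bar> \<le> R"
proof -
  have comp_cols: "compactin (Euclidean_space d) K"
    using assms by (simp add: convex_body_def)
  then show KV: "K \<subseteq> vec_space d"
    by (auto simp: vec_space_def dest: compactin_subset_topspace)
  have "compact K"
    using comp_cols by (simp add: Euclidean_space_def compactin_subtopology euclidean_product_topology)
  then have "bounded ((\<lambda>x. x i) ` K)" for i
    by (intro compact_imp_bounded compact_continuous_image
        continuous_on_subset[OF continuous_on_product_coordinates subset_UNIV])
  then have "\<forall>i. \<exists>R. \<forall>x\<in>K. \<bar>x i\<bar> \<le> R"
    by (simp add: bounded_iff)
  then obtain R where R: "\<And>i x. x \<in> K \<Longrightarrow> \<bar>x i\<bar> \<le> R i"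
    by metis
  have "\<bar>x i\<bar> \<le> (\<Sum>i<d. \<bar>R i\<bar>)" if x: "x \<in> K" for x i
  proof (cases "i < d")
    case True
    have "\<bar>x i\<bar> \<le> \<bar>R i\<bar>" using R[OF x, of i] by simp
    also have "\<dots> \<le> (\<Sum>i<d. \<bar>R i\<bar>)" using True by (intro member_le_sum) auto
    finally show ?thesis .
  next
    case False
    then have "x i = 0" using KV x by (auto simp: vec_space_iff)
    then show ?thesis by (simp add: sum_nonneg)
  qed
  then show "\<exists>R. \<forall>x\<in>K. \<forall>i. \<bar>x i\<bar> \<le> R" by blast
qed

text \<open>If \<open>x\<close> is interior, then \<open>x + s e_j\<close> and, by symmetry,
  \<open>- x\<close> lie in \<open>K\<close>; their midpoint is \<open>(s / 2) e_j\<close>.\<close>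

lemma convex_body_contains_axes:
  assumes "convex_body d K" "origin_symmetric K"
  shows "\<exists>r>0. \<forall>j<d. r *\<^sub>R std_unit j \<in> K"
proof -
  obtain x where x: "x \<in> Euclidean_space d interior_of K"
    using assms(1) by (auto simp: convex_body_def)
  then obtain T where T: "openin (Euclidean_space d) T" "x \<in> T" "T \<subseteq> K"
    by (auto simp: interior_of_def)
  then obtain U where U: "open U" "T = U \<inter> vec_space d"
    by (auto simp: Euclidean_space_def openin_subtopology euclidean_product_topology
        vec_space_def topspace_Euclidean_space)
  have "\<exists>e>0. \<forall>s. \<bar>s\<bar> < e \<longrightarrow> x + s *\<^sub>R std_unit j \<in> U" for j
  proof -
    have "continuous_on UNIV (\<lambda>s::real. x + s *\<^sub>R std_unit j)"
      by (rule continuous_on_coordinatewise_then_product)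
         (auto simp: scaleR_fun_def intro!: continuous_intros)
    then have "open ((\<lambda>s::real. x + s *\<^sub>R std_unit j) -` U)"
      using U(1) open_vimage by blast
    moreover have "0 \<in> (\<lambda>s::real. x + s *\<^sub>R std_unit j) -` U"
      using T(2) U(2) by simp
    ultimately have "\<exists>e>0. \<forall>s. dist s 0 < e \<longrightarrow> s \<in> (\<lambda>s::real. x + s *\<^sub>R std_unit j) -` U"
      unfolding open_dist by blast
    then show ?thesis
      by (simp add: dist_real_def)
  qed
  then obtain e where e: "\<And>j. e j > 0" "\<And>j s. \<bar>s\<bar> < e j \<Longrightarrow> x + s *\<^sub>R std_unit j \<in> U"
    by metis
  \<comment> \<open>One step length for all axes. Inserting 1 keeps \<open>Min\<close> defined for
    \<open>d = 0\<close>, and halving makes \<open>s < e j\<close> strict.\<close>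
  define s where "s = Min (insert 1 (e ` {..<d})) / 2"
  have Min_pos: "Min (insert 1 (e ` {..<d})) > 0"
    using e(1) by (subst Min_gr_iff) auto
  then have s0: "s > 0" unfolding s_def by (rule half_gt_zero)
  have s_lt: "s < e j" if "j < d" for j
  proof -
    have "Min (insert 1 (e ` {..<d})) \<le> e j"
      using that by (intro Min_le) auto
    then show ?thesis using Min_pos unfolding s_def by linarith
  qed
  have xV: "x \<in> vec_space d" using T(2) U(2) by simp
  have "(s / 2) *\<^sub>R std_unit j \<in> K" if j: "j < d" for j
  proof -
    have "x + s *\<^sub>R std_unit j \<in> vec_space d"
      using xV std_unit_in_vec_space[OF j] subspace_vec_space
      by (intro subspace_add subspace_scale) auto
    then have 1: "x + s *\<^sub>R std_unit j \<in> K"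
      using e(2)[of s j] s_lt[OF j] s0 T(3) U(2) by auto
    have 2: "- x \<in> K"
      using T assms(2) by (auto simp: origin_symmetric_def)
    have "(1/2) *\<^sub>R (x + s *\<^sub>R std_unit j) + (1/2) *\<^sub>R (- x) \<in> K"
      using assms(1) 1 2 by (intro convexD) (auto simp: convex_body_def)
    moreover have "(1/2) *\<^sub>R (x + s *\<^sub>R std_unit j) + (1/2) *\<^sub>R (- x) = (s / 2) *\<^sub>R std_unit j"
      by (auto simp: fun_eq_iff scaleR_fun_def algebra_simps)
    ultimately show ?thesis by simp
  qed
  then show ?thesis using s0 by (intro exI[of _ "s / 2"]) auto
qed

text \<open>Signs are moved into the points, the weights are normalised to sum 1, and the result is
  shrunk towards 0.\<close>

lemma absolutely_convex_combination:
  fixes C :: "'a::real_vector set"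
  assumes C: "convex C" "0 \<in> C" and u: "\<And>i. i \<in> I \<Longrightarrow> u i \<in> C \<and> - u i \<in> C"
    and I: "finite I" "(\<Sum>i\<in>I. \<bar>a i\<bar>) \<le> 1"
  shows "(\<Sum>i\<in>I. a i *\<^sub>R u i) \<in> C"
proof (cases "(\<Sum>i\<in>I. \<bar>a i\<bar>) = 0")
  case True
  then have "\<forall>i\<in>I. a i = 0" using I(1) by (simp add: sum_nonneg_eq_0_iff)
  then show ?thesis using C(2) by simp
next
  case False
  define s where "s = (\<Sum>i\<in>I. \<bar>a i\<bar>)"
  have s: "0 < s" "s \<le> 1"
    using False I by (auto simp: s_def less_le sum_nonneg)
  have "(\<Sum>i\<in>I. (\<bar>a i\<bar> / s) *\<^sub>R (if a i \<ge> 0 then u i else - u i)) \<in> C"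
    using C(1) I(1) u s by (intro convex_sum) (auto simp: sum_divide_distrib[symmetric] s_def[symmetric])
  then have "(1 - s) *\<^sub>R 0 + s *\<^sub>R (\<Sum>i\<in>I. (\<bar>a i\<bar> / s) *\<^sub>R (if a i \<ge> 0 then u i else - u i)) \<in> C"
    using C s by (intro convexD) auto
  moreover have "s *\<^sub>R (\<Sum>i\<in>I. (\<bar>a i\<bar> / s) *\<^sub>R (if a i \<ge> 0 then u i else - u i)) = (\<Sum>i\<in>I. a i *\<^sub>R u i)"
    unfolding scaleR_sum_right using s by (intro sum.cong) auto
  ultimately show ?thesis by simp
qed

text \<open>Makes the set in \<open>body_norm\<close> nonempty, so that its infimum is
  meaningful.\<close>

lemma convex_body_absorbs:
  assumes "convex_body d K" "origin_symmetric K" "d > 0" "x \<in> vec_space d"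
  shows "\<exists>l>0. x \<in> (\<lambda>y. l *\<^sub>R y) ` K"
proof -
  obtain r where r: "r > 0" "\<And>j. j < d \<Longrightarrow> r *\<^sub>R std_unit j \<in> K"
    using convex_body_contains_axes[OF assms(1,2)] by blast
  have sym: "y \<in> K \<Longrightarrow> - y \<in> K" for y
    using assms(2) by (simp add: origin_symmetric_def)
  have cK: "convex K" using assms(1) by (simp add: convex_body_def)
  have "(1/2) *\<^sub>R (r *\<^sub>R std_unit 0) + (1/2) *\<^sub>R (- (r *\<^sub>R std_unit 0)) \<in> K"
    using r(2)[OF assms(3)] sym by (intro convexD[OF cK]) auto
  then have zK: "0 \<in> K" by simp
  \<comment> \<open>Chosen so that \<open>l * r\<close> is at least the absolute sum of the
    coordinates; the \<open>+ 1\<close> keeps \<open>l\<close> positive at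
    \<open>x = 0\<close>.\<close>
  define l where "l = (\<Sum>j<d. \<bar>x j\<bar>) / r + 1"
  have l: "l > 0"
    using r(1) by (simp add: l_def add_nonneg_pos sum_nonneg)
  have "(\<Sum>j<d. \<bar>x j / (l * r)\<bar>) = (\<Sum>j<d. \<bar>x j\<bar>) / (l * r)"
    using l r(1) by (simp add: sum_divide_distrib abs_mult)
  also have "\<dots> \<le> 1"
  proof -
    have "l * r = (\<Sum>j<d. \<bar>x j\<bar>) + r"
      using r(1) by (simp add: l_def field_simps)
    then show ?thesis
      using r(1) mult_pos_pos[OF l r(1)] by (subst divide_le_eq_1_pos) simp_all
  qed
  finally have "(\<Sum>j<d. (x j / (l * r)) *\<^sub>R (r *\<^sub>R std_unit j)) \<in> K"
    using r(2) sym by (intro absolutely_convex_combination[OF cK zK]) auto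
  also have "(\<Sum>j<d. (x j / (l * r)) *\<^sub>R (r *\<^sub>R std_unit j)) = (1 / l) *\<^sub>R (\<Sum>j<d. x j *\<^sub>R std_unit j)"
    unfolding scaleR_sum_right using r(1) by (intro sum.cong) auto
  also have "(\<Sum>j<d. x j *\<^sub>R std_unit j) = x"
    using col_comb_unit[OF assms(4)] by (simp add: col_comb_eq_sum)
  finally have "(1 / l) *\<^sub>R x \<in> K" .
  then have "x \<in> (\<lambda>y. l *\<^sub>R y) ` K"
    using l by (intro image_eqI[of _ _ "(1 / l) *\<^sub>R x"]) auto
  then show ?thesis using l by blast
qed

section \<open>Upper bound: a cheap covering family\<close>

lemma body_norm_nonneg:
  assumes "\<exists>l>0. x \<in> (\<lambda>y. l *\<^sub>R y) ` K"
  shows "body_norm K x \<ge> 0"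
  unfolding body_norm_def using assms by (intro cInf_greatest) auto

lemma body_norm_le:
  assumes "l > 0" "x \<in> (\<lambda>y. l *\<^sub>R y) ` K"
  shows "body_norm K x \<le> l"
  unfolding body_norm_def using assms by (intro cInf_lower bdd_belowI[of _ 0]) auto

text \<open>In the coordinates of the approximate Auerbach basis, \<open>K\<close> satisfies the
  hypotheses of \<open>exists_spans_with\<close>. The constant is \<open>32 = 2 * 8 * 2\<close>:
  both signs, the number of points, and the scaling \<open>2 * sqrt d\<close>.\<close>

lemma exists_covering_points:
  assumes K: "convex_body d K" "origin_symmetric K" and d: "d \<ge> 2"
  shows "\<exists>ps. set ps \<subseteq> vec_space d \<and> K \<subseteq> convex hull (set ps) \<and>
    (\<Sum>p\<leftarrow>ps. body_norm K p) \<le> 32 * real d powr (3/2) * ln (2 * real d)"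
proof -
  have KV: "K \<subseteq> vec_space d" by (rule convex_body_bounded[OF K(1)])
  obtain R where R: "\<And>x i. x \<in> K \<Longrightarrow> \<bar>x i\<bar> \<le> R"
    using convex_body_bounded(2)[OF K(1)] by blast
  obtain r where r: "r > 0" "\<And>j. j < d \<Longrightarrow> r *\<^sub>R std_unit j \<in> K"
    using convex_body_contains_axes[OF K] by blast
  have sym: "y \<in> K \<Longrightarrow> - y \<in> K" for y
    using K(2) by (simp add: origin_symmetric_def)
  obtain b where b: "\<And>j. j < d \<Longrightarrow> b j \<in> K"
    "\<And>x. x \<in> K \<Longrightarrow> \<exists>c. (\<forall>i<d. x i = (\<Sum>j<d. c j * b j i)) \<and> (\<forall>j<d. \<bar>c j\<bar> \<le> 2)"
    using auerbach_basis[of K R r d] R r by blast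
  have bV: "col_comb d b c \<in> vec_space d" for c
    using b(1) KV by (intro col_comb_in_vec_space) auto
  \<comment> \<open>Coordinate vectors of points of \<open>K\<close>; the bound 2 is the one
    supplied by \<open>auerbach_basis\<close>.\<close>
  define S where "S = {c. (\<forall>j<d. \<bar>c j\<bar> \<le> 2) \<and> col_comb d b c \<in> K}"
  have "std_unit j \<in> S" if "j < d" for j
  proof -
    have "col_comb d b (std_unit j) = b j"
      using that by (auto simp: col_comb_def std_unit_def fun_eq_iff if_distrib[of "\<lambda>y. y * _"] cong: if_cong)
    then show ?thesis using b(1)[OF that] by (simp add: S_def std_unit_def)
  qed
  then obtain n f where n: "real n \<le> 8 * real d * ln (2 * real d)" and f: "spans_with d S n f"
    using exists_spans_with[OF d, of S] by (auto simp: S_def)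
  define u where "u i = col_comb d b (f i)" for i
  have uK: "u i \<in> K" if "i < n" for i
    using f that by (auto simp: spans_with_def S_def u_def)
  define q where "q = 2 * sqrt d"
  have q: "q > 0" using d by (simp add: q_def)
  define ps where "ps = map (\<lambda>i. q *\<^sub>R u i) [0..<n] @ map (\<lambda>i. - (q *\<^sub>R u i)) [0..<n]"
  let ?C = "convex hull (set ps)"
  have psC: "q *\<^sub>R u i \<in> ?C \<and> - (q *\<^sub>R u i) \<in> ?C" if "i < n" for i
    using that by (auto simp: ps_def intro!: hull_inc)
  have rep: "\<exists>a. x = (\<Sum>i<n. a i *\<^sub>R u i) \<and> (\<Sum>i<n. \<bar>a i\<bar>) \<le> q" if x: "x \<in> K" for x
  proof -
    obtain c where c: "\<forall>i<d. x i = (\<Sum>j<d. c j * b j i)" "\<forall>j<d. \<bar>c j\<bar> \<le> 2"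
      using b(2)[OF x] by blast
    have "x i = col_comb d b c i" for i
    proof (cases "i < d")
      case True
      then show ?thesis using c(1) by (simp add: col_comb_def)
    next
      case False
      then show ?thesis using x KV bV[of c] by (auto simp: vec_space_iff)
    qed
    then have xc: "x = col_comb d b c" by blast
    then have "c \<in> S" using x c(2) by (simp add: S_def)
    then obtain a where a: "\<forall>j<d. c j = (\<Sum>i<n. a i * f i j)" "(\<Sum>i<n. \<bar>a i\<bar>) \<le> q"
      using f unfolding spans_with_def q_def by blast
    have "x = (\<Sum>j<d. \<Sum>i<n. (a i * f i j) *\<^sub>R b j)"
      using a(1) by (simp add: xc col_comb_eq_sum scaleR_sum_left)
    also have "\<dots> = (\<Sum>i<n. \<Sum>j<d. (a i * f i j) *\<^sub>R b j)"
      by (rule sum.swap)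
    also have "\<dots> = (\<Sum>i<n. a i *\<^sub>R u i)"
      by (simp add: u_def col_comb_eq_sum scaleR_sum_right)
    finally show ?thesis using a(2) by blast
  qed
  \<comment> \<open>Needed to have a point whose midpoint with its negative puts 0 into the
    hull.\<close>
  have "n > 0"
  proof (rule ccontr)
    assume "\<not> n > 0"
    then have "r *\<^sub>R std_unit 0 = 0"
      using rep[OF r(2)[of 0]] d by auto
    from fun_cong[OF this, of 0] show False using r(1) by (simp add: std_unit_def scaleR_fun_def)
  qed
  have "(1/2) *\<^sub>R (q *\<^sub>R u 0) + (1/2) *\<^sub>R (- (q *\<^sub>R u 0)) \<in> ?C"
    using psC[OF \<open>n > 0\<close>] by (intro convexD[OF convex_convex_hull]) auto
  then have zC: "0 \<in> ?C" by simp
  have "K \<subseteq> ?C"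
  proof
    fix x assume "x \<in> K"
    then obtain a where a: "x = (\<Sum>i<n. a i *\<^sub>R u i)" "(\<Sum>i<n. \<bar>a i\<bar>) \<le> q"
      using rep by blast
    have "(\<Sum>i<n. \<bar>a i / q\<bar>) \<le> 1"
      using a(2) q by (simp add: sum_divide_distrib[symmetric])
    then have "(\<Sum>i<n. (a i / q) *\<^sub>R (q *\<^sub>R u i)) \<in> ?C"
      using psC by (intro absolutely_convex_combination[OF convex_convex_hull zC]) auto
    then show "x \<in> ?C" using q a(1) by simp
  qed
  moreover have "set ps \<subseteq> vec_space d"
  proof -
    have "q *\<^sub>R u i \<in> vec_space d" "- (q *\<^sub>R u i) \<in> vec_space d" if "i < n" for i
      using subspace_scale[OF subspace_vec_space, of "u i" d q] subspace_neg[OF subspace_vec_space, of "q *\<^sub>R u i" d]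
        uK[OF that] KV by auto
    then show ?thesis
      unfolding ps_def by auto
  qed
  moreover have "(\<Sum>p\<leftarrow>ps. body_norm K p) \<le> 32 * real d powr (3/2) * ln (2 * real d)"
  proof -
    have "body_norm K p \<le> q" if "p \<in> set ps" for p
    proof -
      have "\<exists>i<n. p = q *\<^sub>R u i \<or> p = q *\<^sub>R (- u i)"
        using that unfolding ps_def by auto
      then obtain i where i: "i < n" "p = q *\<^sub>R u i \<or> p = q *\<^sub>R (- u i)" by blast
      then have "p \<in> (\<lambda>y. q *\<^sub>R y) ` K"
        using uK sym by blast
      then show ?thesis using q by (intro body_norm_le)
    qed
    then have "(\<Sum>p\<leftarrow>ps. body_norm K p) \<le> (\<Sum>p\<leftarrow>ps. q)"
      by (intro sum_list_mono)
    also have "\<dots> = 2 * real n * q"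
      by (simp add: sum_list_triv ps_def)
    also have "\<dots> \<le> 2 * (8 * real d * ln (2 * real d)) * q"
      using n q by simp
    also have "\<dots> = 32 * (real d * sqrt d) * ln (2 * real d)"
      by (simp add: q_def)
    also have "real d * sqrt d = real d powr (3/2)"
    proof -
      have "real d powr (3/2) = real d powr (1 + 1/2)" by simp
      also have "\<dots> = real d powr 1 * real d powr (1/2)" by (rule powr_add)
      finally show ?thesis using d by (simp add: powr_half_sqrt)
    qed
    finally show ?thesis .
  qed
  ultimately show ?thesis by blast
qed

section \<open>Lower bound: every covering family against every ellipsoid\<close>

text \<open>Repetitions in a family only add to its cost, so the volume estimate may work with the
  underlying set.\<close>

lemma sum_set_le_sum_list:
  fixes g :: "'a \<Rightarrow> real"
  assumes "\<And>x. x \<in> set xs \<Longrightarrow> g x \<ge> 0"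
  shows "(\<Sum>x\<in>set xs. g x) \<le> (\<Sum>x\<leftarrow>xs. g x)"
  using assms by (induction xs) (auto simp: sum.insert_if intro: add_increasing)

text \<open>A large ball. It makes the set in \<open>ovr\<close> nonempty, so that its infimum can
  be bounded from below.\<close>

lemma exists_ellipsoid:
  assumes "K \<subseteq> vec_space d" "\<And>x i. x \<in> K \<Longrightarrow> \<bar>x i\<bar> \<le> R" "d > 0"
  shows "\<exists>E. ellipsoid d E \<and> K \<subseteq> E"
proof -
  define s where "s = sqrt d * (\<bar>R\<bar> + 1)"
  have s: "s > 0" using assms(3) by (simp add: s_def)
  define E where "E = (\<lambda>x. 0 + s *\<^sub>R x) ` unit_ball d"
  have "(\<lambda>x. s *\<^sub>R x) ` vec_space d = vec_space d"
  proof (intro equalityI subsetI)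
    fix x assume "x \<in> vec_space d"
    then have "(1 / s) *\<^sub>R x \<in> vec_space d" "x = s *\<^sub>R ((1 / s) *\<^sub>R x)"
      using s subspace_scale[OF subspace_vec_space] by auto
    then show "x \<in> (\<lambda>x. s *\<^sub>R x) ` vec_space d" by blast
  qed (use subspace_scale[OF subspace_vec_space] in auto)
  moreover have "linear (\<lambda>x::nat\<Rightarrow>real. s *\<^sub>R x)"
    by (rule linear_scale_self)
  ultimately have "ellipsoid d E"
    unfolding ellipsoid_def E_def
    by (intro exI[of _ "\<lambda>x. s *\<^sub>R x"] exI[of _ 0]) (auto simp: vec_space_iff)
  moreover have "K \<subseteq> E"
  proof
    fix x assume x: "x \<in> K"
    have "norm_sq d ((1 / s) *\<^sub>R x) \<le> real d * (\<bar>R\<bar> / s)\<^sup>2"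
    proof (rule norm_sq_le_of_abs)
      fix i
      have "\<bar>x i\<bar> \<le> \<bar>R\<bar>" using assms(2)[OF x, of i] by simp
      then show "\<bar>((1 / s) *\<^sub>R x) i\<bar> \<le> \<bar>R\<bar> / s"
        using s by (simp add: scaleR_fun_def abs_mult divide_right_mono)
    qed
    also have "\<dots> = (\<bar>R\<bar> / (\<bar>R\<bar> + 1))\<^sup>2"
      using assms(3) by (simp add: s_def power_divide power_mult_distrib)
    also have "\<dots> \<le> 1"
      by (simp add: power_le_one)
    finally have "(1 / s) *\<^sub>R x \<in> unit_ball d"
      using x assms(1) subspace_scale[OF subspace_vec_space] by (auto simp: unit_ball_def norm_sq_def)
    moreover have "x = 0 + s *\<^sub>R ((1 / s) *\<^sub>R x)" using s by simp
    ultimately show "x \<in> E" unfolding E_def by blast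
  qed
  ultimately show ?thesis by blast
qed

lemma ovr_bound_le_covering:
  assumes K: "convex_body d K" "origin_symmetric K" and d: "d \<ge> 2"
    and ps: "set ps \<subseteq> vec_space d" "K \<subseteq> convex hull (set ps)"
  shows "real d powr (3/2) / (sqrt (2 * pi * exp 1) * ovr d K) \<le> (\<Sum>p\<leftarrow>ps. body_norm K p)"
proof -
  have d0: "d > 0" using d by simp
  have KV: "K \<subseteq> vec_space d" by (rule convex_body_bounded[OF K(1)])
  obtain R where R: "\<And>x i. x \<in> K \<Longrightarrow> \<bar>x i\<bar> \<le> R"
    using convex_body_bounded(2)[OF K(1)] by blast
  obtain r where r: "r > 0" "\<And>j. j < d \<Longrightarrow> r *\<^sub>R std_unit j \<in> K"
    using convex_body_contains_axes[OF K] by blast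
  let ?O = "{root d (vol d E / vol d K) | E. ellipsoid d E \<and> K \<subseteq> E}"
  have ex_E: "\<exists>E. ellipsoid d E \<and> K \<subseteq> E"
    using R by (intro exists_ellipsoid[OF KV _ d0]) auto
  then have O_ne: "?O \<noteq> {}"
    by blast
  define s where "s = (\<Sum>p\<leftarrow>ps. body_norm K p)"
  define c where "c = real d powr (3/2) / sqrt (2 * pi * exp 1)"
  have c: "c > 0" using d by (simp add: c_def)
  have absorb: "\<exists>l>0. p \<in> (\<lambda>y. l *\<^sub>R y) ` K" if "p \<in> set ps" for p
    using ps(1) that by (intro convex_body_absorbs[OF K d0]) auto
  have s_ge: "(\<Sum>p\<in>set ps. body_norm K p) \<le> s"
    unfolding s_def using absorb by (intro sum_set_le_sum_list body_norm_nonneg)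
  have set_nonneg: "(\<Sum>p\<in>set ps. body_norm K p) \<ge> 0"
    using absorb by (intro sum_nonneg body_norm_nonneg)
  have s0: "s \<ge> 0" using s_ge set_nonneg by linarith
  have main: "c / ovr d K \<le> s"
  proof (cases "vol d K = 0")
    case True
    \<comment> \<open>The outer volume ratio is then 0 and so is the quotient by it.\<close>
    then have "?O \<subseteq> {0}" by auto
    with O_ne have "?O = {0}" by (metis (lifting) subset_singletonD)
    then have "ovr d K = 0" unfolding ovr_def by simp
    then show ?thesis using s0 by simp
  next
    case False
    then have vK: "vol d K > 0"
      unfolding vol_def by (simp add: less_le)
    \<comment> \<open>The hull contains \<open>K\<close> and with it a positive multiple of every
      unit vector.\<close>
    have span: "vec_space d \<subseteq> span (set ps)"
    proof -
      have "std_unit j \<in> span (set ps)" if "j < d" for j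
      proof -
        have "r *\<^sub>R std_unit j \<in> span (set ps)"
          by (rule subsetD[OF convex_hull_subset_span subsetD[OF ps(2) r(2)[OF that]]])
        then have "(1 / r) *\<^sub>R (r *\<^sub>R std_unit j) \<in> span (set ps)"
          by (rule span_scale)
        then show ?thesis using r(1) by simp
      qed
      then have "span (std_unit ` {..<d}) \<subseteq> span (set ps)"
        by (intro span_minimal) auto
      then show ?thesis by (simp add: span_std_unit)
    qed
    have key: "c ^ d * vol d K \<le> vol d E * s ^ d" if E: "ellipsoid d E" "K \<subseteq> E" for E
    proof -
      have "c ^ d * vol d K \<le> vol d K * ((fact d)\<^sup>2 * (2 / sqrt d) ^ d)"
        using lower_bound_constant[OF d0] vK by (simp add: c_def mult.commute mult_left_mono)
      also have "\<dots> \<le> vol d E * (\<Sum>p\<in>set ps. body_norm K p) ^ d"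
        by (rule vol_hull_ellipsoid_le[OF E K(2) finite_set ps(1) span ps(2) absorb d0])
      also have "\<dots> \<le> vol d E * s ^ d"
        using s_ge set_nonneg by (intro mult_left_mono power_mono) (auto simp: vol_def)
      finally show ?thesis .
    qed
    \<comment> \<open>Cost 0 would force \<open>K\<close> to have volume 0 by
      \<open>key\<close>.\<close>
    have sp: "s > 0"
    proof (rule ccontr)
      assume "\<not> s > 0"
      then have "s = 0" using s0 by simp
      moreover obtain E where "ellipsoid d E" "K \<subseteq> E"
        using ex_E by blast
      ultimately have "c ^ d * vol d K \<le> 0"
        using key[of E] d0 by (simp add: zero_power)
      moreover have "c ^ d * vol d K > 0" using c vK by simp
      ultimately show False by linarith
    qed
    \<comment> \<open>The \<open>d\<close>-th root of \<open>key\<close> bounds every member of the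
      infimum; as \<open>c / s\<close> is positive, the inequality can be inverted
      afterwards.\<close>
    have "c / s \<le> ovr d K"
      unfolding ovr_def
    proof (rule cInf_greatest[OF O_ne])
      fix t assume "t \<in> ?O"
      then obtain E where E: "t = root d (vol d E / vol d K)" "ellipsoid d E" "K \<subseteq> E" by blast
      have "(c / s) ^ d \<le> vol d E / vol d K"
        using key[OF E(2,3)] sp vK by (simp add: power_divide field_simps)
      then have "root d ((c / s) ^ d) \<le> t"
        unfolding E(1) using d0 by simp
      then show "c / s \<le> t"
        using c sp d0 by (simp add: real_root_power_cancel)
    qed
    moreover have "c / s > 0" using c sp by simp
    ultimately have "ovr d K > 0" "c / s \<le> ovr d K" by linarith+
    then show ?thesis
      using sp by (simp add: pos_divide_le_eq mult.commute)
  qed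
  then show ?thesis by (simp add: c_def s_def)
qed

theorem theoremC:
  shows "\<exists>C::real. C > 0 \<and>
    (\<forall>(d::nat) \<ge> 2. \<forall>K :: (nat \<Rightarrow> real) set. convex_body d K \<and> origin_symmetric K \<longrightarrow>
      real d powr (3/2) / (sqrt (2 * pi * exp 1) * ovr d K) \<le> vein d K \<and>
      vein d K \<le> C * real d powr (3/2) * ln (2 * real d))"
proof (intro exI[of _ 32] conjI allI impI)
  fix d :: nat and K :: "(nat \<Rightarrow> real) set"
  assume d: "d \<ge> 2" and "convex_body d K \<and> origin_symmetric K"
  then have K: "convex_body d K" "origin_symmetric K" by auto
  let ?V = "{\<Sum>p\<leftarrow>ps. body_norm K p | ps. set ps \<subseteq> vec_space d \<and> K \<subseteq> convex hull (set ps)}"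
  obtain ps where ps: "set ps \<subseteq> vec_space d" "K \<subseteq> convex hull (set ps)"
    "(\<Sum>p\<leftarrow>ps. body_norm K p) \<le> 32 * real d powr (3/2) * ln (2 * real d)"
    using exists_covering_points[OF K d] by blast
  show "real d powr (3/2) / (sqrt (2 * pi * exp 1) * ovr d K) \<le> vein d K"
    unfolding vein_def
  proof (rule cInf_greatest)
    show "?V \<noteq> {}" using ps by blast
  qed (use ovr_bound_le_covering[OF K d] in blast)
  \<comment> \<open>The lower bound also supplies the boundedness below that the upper estimate of
    the infimum requires.\<close>
  have "bdd_below ?V"
    using ovr_bound_le_covering[OF K d] by (intro bdd_belowI) blast
  then have "vein d K \<le> (\<Sum>p\<leftarrow>ps. body_norm K p)"
    unfolding vein_def using ps by (intro cInf_lower) blast+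
  then show "vein d K \<le> 32 * real d powr (3/2) * ln (2 * real d)"
    using ps(3) by linarith
qed simp


end
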